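(* Let $m,n\ge 0$ be integers. With respect to the metric topology induced by the norm $\|\cdot\|$ on $P_{m,n}$, for every integer $k$ with $0\le k\le \min\{m,n\}$ the subset $\mathcal{P}^k_{m,n}$ of $P_{m,n}$ is a differentiable manifold of codimension $k$. Moreover, for $0\le j,k\le\min\{m,n\}$, one has $\mathcal{P}^j_{m,n}\subset \overline{\mathcal{P}^k_{m,n}}$ (closure in $P_{m,n}$) if and only if $j\ge k$, and $\mathcal{P}^0_{m,n}$ is open and dense in $P_{m,n}$.
   Context: All polynomials are in $\mathbb{C}[x]$, one variable. $P_n$ is the vector space of polynomials of degree at most $n$ (including $0$); $\|p\|$ is the Euclidean norm of the coefficient vector of $p$. $P_{m,n}=P_m\times P_n$, with norm $\|(p,q)\|=\sqrt{\|p\|^2+\|q\|^2}$, a complex vector space of dimension $m+n+2$. $\mathcal{P}_{m,n}=\{(p,q)\in P_{m,n} : \deg p=m,\ \deg q=n\}$. A GCD of $(p,q)$ is any polynomial of highest degree dividing both $p$ and $q$ (not necessarily monic). $\mathcal{P}^k_{m,n}=\{(p,q)\in\mathcal{P}_{m,n} : \text{the GCDs of }(p,q)\text{ have degree } k\}$. A subset $\Pi\subset P_{m,n}$ is called a differentiable manifold of dimension $d$ if for every $(p,q)\in\Pi$ there are an open neighborhood $\Delta$ of $(p,q)$ in $P_{m,n}$ and a continuously differentiable mapping $g$ from $\Delta\cap\Pi$ to an open subset $\Lambda$ of $\mathbb{C}^d$ having a continuously differentiable inverse $g^{-1}:\Lambda\to\Delta\cap\Pi$. The codimension of $\Pi$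 is $m+n+2-d$. *)

theory Defs
  imports
    "HOL-Analysis.Analysis"
    "HOL-Analysis.Finite_Function_Topology"
    "HOL-Computational_Algebra.Polynomial"
begin

text \<open>A copy of the complex polynomials, to carry the Euclidean norm of the coefficient vector: the
  type \<open>poly\<close> itself cannot be made a \<open>real_normed_vector\<close>, as its \<open>sgn\<close> is already in use for
  ordered coefficients. The product instance of the library then gives the pair norm, the square
  root of the sum of the squares of the two norms.\<close>

typedef npoly = "UNIV :: complex poly set"
  morphisms poly_of npoly_of
  by simp

setup_lifting type_definition_npoly

instantiation npoly :: real_vector
begin

lift_definition zero_npoly :: npoly is 0 .
lift_definition plus_npoly :: "npoly \<Rightarrow> npoly \<Rightarrow> npoly" is "(+)" .
lift_definition minus_npoly :: "npoly \<Rightarrow> npoly \<Rightarrow> npoly" is "(-)" .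
lift_definition uminus_npoly :: "npoly \<Rightarrow> npoly" is uminus .
lift_definition scaleR_npoly :: "real \<Rightarrow> npoly \<Rightarrow> npoly" is "\<lambda>r. smult (complex_of_real r)" .

instance
  by standard (transfer; simp add: smult_add_right smult_add_left)+

end

lift_definition scale_npoly :: "complex \<Rightarrow> npoly \<Rightarrow> npoly" is smult .

instantiation npoly :: real_normed_vector
begin

lift_definition norm_npoly :: "npoly \<Rightarrow> real"
  is "\<lambda>p. L2_set (\<lambda>i. norm (coeff p i)) {..degree p}" .

definition dist_npoly :: "npoly \<Rightarrow> npoly \<Rightarrow> real"
  where "dist_npoly p q = norm (p - q)"

definition sgn_npoly :: "npoly \<Rightarrow> npoly"
  where "sgn_npoly p = inverse (norm p) *\<^sub>R p"

definition uniformity_npoly :: "(npoly \<times> npoly) filter"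
  where "uniformity_npoly = (INF e\<in>{0<..}. principal {(p, q). dist p q < e})"

definition open_npoly :: "npoly set \<Rightarrow> bool"
  where "open_npoly U = (\<forall>p\<in>U. eventually (\<lambda>(p', q). p' = p \<longrightarrow> q \<in> U) uniformity)"

lemma norm_npoly_bound:
  assumes "degree (poly_of p) \<le> n"
  shows "norm p = L2_set (\<lambda>i. norm (coeff (poly_of p) i)) {..n}"
proof -
  have "(\<Sum>i\<le>degree (poly_of p). (norm (coeff (poly_of p) i))\<^sup>2)
      = (\<Sum>i\<le>n. (norm (coeff (poly_of p) i))\<^sup>2)"
    by (rule sum.mono_neutral_left) (use assms in \<open>auto simp: coeff_eq_0\<close>)
  then show ?thesis
    by (simp add: norm_npoly.rep_eq L2_set_def)
qed

instance
proof
  fix p q :: npoly and r :: real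
  show "(norm p = 0) = (p = 0)"
  proof
    assume "norm p = 0"
    then have "\<forall>i\<le>degree (poly_of p). coeff (poly_of p) i = 0"
      by (simp add: norm_npoly.rep_eq L2_set_eq_0_iff)
    then have "poly_of p = 0"
      using leading_coeff_0_iff by blast
    then show "p = 0"
      by (metis poly_of_inverse zero_npoly.abs_eq)
  qed (simp add: norm_npoly.rep_eq zero_npoly.rep_eq)
  show "norm (p + q) \<le> norm p + norm q"
  proof -
    define n where "n = max (degree (poly_of p)) (degree (poly_of q))"
    have d: "degree (poly_of p) \<le> n" "degree (poly_of q) \<le> n" "degree (poly_of (p + q)) \<le> n"
      by (auto simp: n_def plus_npoly.rep_eq degree_add_le_max)
    have "L2_set (\<lambda>i. norm (coeff (poly_of p) i + coeff (poly_of q) i)) {..n}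
        \<le> L2_set (\<lambda>i. norm (coeff (poly_of p) i) + norm (coeff (poly_of q) i)) {..n}"
      by (rule L2_set_mono) (auto intro: norm_triangle_ineq)
    also have "\<dots> \<le> L2_set (\<lambda>i. norm (coeff (poly_of p) i)) {..n}
        + L2_set (\<lambda>i. norm (coeff (poly_of q) i)) {..n}"
      by (rule L2_set_triangle_ineq)
    finally show ?thesis
      by (simp add: norm_npoly_bound[OF d(1)] norm_npoly_bound[OF d(2)] norm_npoly_bound[OF d(3)]
          plus_npoly.rep_eq)
  qed
  show "norm (r *\<^sub>R p) = \<bar>r\<bar> * norm p"
  proof -
    have "degree (poly_of (r *\<^sub>R p)) \<le> degree (poly_of p)"
      by (simp add: scaleR_npoly.rep_eq)
    from norm_npoly_bound[OF this] show ?thesis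
      by (simp add: norm_npoly_bound[OF order_refl, of p] scaleR_npoly.rep_eq norm_mult
          L2_set_right_distrib)
  qed
qed (simp_all only: dist_npoly_def sgn_npoly_def uniformity_npoly_def open_npoly_def)

end

definition scale_pair :: "complex \<Rightarrow> npoly \<times> npoly \<Rightarrow> npoly \<times> npoly"
  where "scale_pair c x = (scale_npoly c (fst x), scale_npoly c (snd x))"

definition scale_coord :: "complex \<Rightarrow> (nat \<Rightarrow>\<^sub>0 complex) \<Rightarrow> (nat \<Rightarrow>\<^sub>0 complex)"
  where "scale_coord c = Poly_Mapping.map (\<lambda>x. c * x)"

lemma vector_space_scale_pair: "vector_space scale_pair"
  unfolding vector_space_def scale_pair_def
  by (auto simp: prod_eq_iff; transfer; simp add: smult_add_right smult_add_left)

lemma lookup_scale_coord [simp]: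
  "Poly_Mapping.lookup (scale_coord c x) i = c * Poly_Mapping.lookup x i"
  by (simp add: scale_coord_def Poly_Mapping.map.rep_eq when_def)

lemma vector_space_scale_coord: "vector_space scale_coord"
  unfolding vector_space_def
  by (auto intro!: poly_mapping_eqI simp: lookup_add algebra_simps)

text \<open>Complex coordinate \<open>d\<close>-space, as the sequences that vanish from index \<open>d\<close> on, since \<open>d\<close> has
  to vary within a statement. The library norm on finitely supported functions is the sum of the
  absolute values of the entries, so it induces the usual topology and differentiability.\<close>

definition coord_space :: "nat \<Rightarrow> (nat \<Rightarrow>\<^sub>0 complex) set"
  where "coord_space d = {x. Poly_Mapping.keys x \<subseteq> {..<d}}"

definition polys :: "nat \<Rightarrow> npoly set"
  where "polys n = {p. degree (poly_of p) \<le> n}"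

definition poly_pairs :: "nat \<Rightarrow> nat \<Rightarrow> (npoly \<times> npoly) set"
  where "poly_pairs m n = polys m \<times> polys n"

text \<open>The zero polynomial has no degree in the mathematical convention, whereas \<open>degree 0 = 0\<close> here;
  the explicit \<open>p \<noteq> 0\<close> and \<open>q \<noteq> 0\<close> matter for \<open>m = 0\<close> and \<open>n = 0\<close>.\<close>

definition exact_pairs :: "nat \<Rightarrow> nat \<Rightarrow> (npoly \<times> npoly) set"
  where "exact_pairs m n =
    {(p, q) \<in> poly_pairs m n. p \<noteq> 0 \<and> degree (poly_of p) = m \<and>
      q \<noteq> 0 \<and> degree (poly_of q) = n}"

definition is_GCD :: "complex poly \<Rightarrow> complex poly \<Rightarrow> complex poly \<Rightarrow> bool"
  where "is_GCD g p q \<longleftrightarrow> g dvd p \<and> g dvd q \<and> (\<forall>h. h dvd p \<and> h dvd q \<longrightarrow> degree h \<le> degree g)"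

definition gcd_pairs :: "nat \<Rightarrow> nat \<Rightarrow> nat \<Rightarrow> (npoly \<times> npoly) set"
  where "gcd_pairs m n k = {(p, q) \<in> exact_pairs m n.
      \<forall>g. is_GCD g (poly_of p) (poly_of q) \<longrightarrow> degree g = k}"

text \<open>\<open>f\<close> is a continuously (complex) differentiable map from the subset \<open>S\<close> of the space \<open>V\<close> to the
  space \<open>W\<close>, with \<open>sV\<close> and \<open>sW\<close> the scalar multiplications. As \<open>S\<close> need not be open in \<open>V\<close>, this
  means that near each point of \<open>S\<close> the map has a \<open>C\<^sup>1\<close> extension \<open>F\<close> to a neighbourhood
  open in \<open>V\<close>; if \<open>S\<close> is open in \<open>V\<close>, it is ordinary continuous differentiability on \<open>S\<close>. \<open>F'\<close> is
  continuous for the operator norm.\<close>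

definition C1_map ::
  "(complex \<Rightarrow> 'a \<Rightarrow> 'a) \<Rightarrow> 'a::real_normed_vector set \<Rightarrow>
   (complex \<Rightarrow> 'b \<Rightarrow> 'b) \<Rightarrow> 'b::real_normed_vector set \<Rightarrow> 'a set \<Rightarrow> ('a \<Rightarrow> 'b) \<Rightarrow> bool"
  where "C1_map sV V sW W S f \<longleftrightarrow>
    (\<forall>x\<in>S. \<exists>U F. \<exists>F' :: 'a \<Rightarrow> 'a \<Rightarrow>\<^sub>L 'b.
       openin (top_of_set V) U \<and> x \<in> U \<and> F ` U \<subseteq> W \<and> (\<forall>y\<in>S \<inter> U. F y = f y) \<and>
       (\<forall>y\<in>U. Vector_Spaces.linear sV sW (blinfun_apply (F' y)) \<and>
              (F has_derivative blinfun_apply (F' y)) (at y within V)) \<and>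
       continuous_on U F')"

definition differentiable_manifold ::
  "nat \<Rightarrow> nat \<Rightarrow> nat \<Rightarrow> (npoly \<times> npoly) set \<Rightarrow> bool"
  where "differentiable_manifold m n d M \<longleftrightarrow>
    M \<subseteq> poly_pairs m n \<and>
    (\<forall>x\<in>M. \<exists>D L g h.
       openin (top_of_set (poly_pairs m n)) D \<and> x \<in> D \<and>
       openin (top_of_set (coord_space d)) L \<and>
       g ` (D \<inter> M) = L \<and> h ` L = D \<inter> M \<and>
       (\<forall>y\<in>D \<inter> M. h (g y) = y) \<and> (\<forall>z\<in>L. g (h z) = z) \<and>
       C1_map scale_pair (poly_pairs m n) scale_coord (coord_space d) (D \<inter> M) g \<and>
       C1_map scale_coord (coord_space d) scale_pair (poly_pairs m n) L h)"

definition manifold_of_codim ::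
  "nat \<Rightarrow> nat \<Rightarrow> nat \<Rightarrow> (npoly \<times> npoly) set \<Rightarrow> bool"
  where "manifold_of_codim m n c M \<longleftrightarrow> (\<exists>d. differentiable_manifold m n d M \<and> c + d = m + n + 2)"

end

theory Submission
  imports Defs
    "HOL-Computational_Algebra.Field_as_Ring"
    "HOL-Computational_Algebra.Polynomial_Factorial"
    "HOL-Computational_Algebra.Fundamental_Theorem_Algebra"
begin

text \<open>A pair of exact degrees \<open>m\<close> and \<open>n\<close> whose gcd has degree \<open>k\<close> is \<open>(u v, u w)\<close> for exactly one monic \<open>u\<close> of
degree \<open>k\<close> and coprime cofactors \<open>v\<close>, \<open>w\<close> of degrees \<open>m - k\<close> and \<open>n - k\<close>. The \<open>k + (m - k + 1) + (n - k + 1)\<close>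
free coefficients are global coordinates on the stratum, which accounts for the codimension \<open>k\<close>.

The parametrization \<open>(u, v, w) \<mapsto> (u v, u w)\<close> is polynomial. What needs an argument is that its inverse is
locally the restriction of a C1 map on an open set of pairs. The coefficients of \<open>v\<close> and \<open>w\<close>, and then
those of \<open>u\<close>, solve linear systems whose coefficients are C1 functions of the pair and whose
matrices are injective at the given point. By Gaussian elimination the solutions of such a system are C1 functions,
also when it is overdetermined (\<open>C1_near_linear_system\<close>). For \<open>v\<close> and \<open>w\<close> the matrix is that of
syzygies of bounded degree, and its injectivity characterizes the pairs whose gcd has degree at most \<open>k\<close>
(\<open>degree_gcd_le_iff_syzygy_trivial\<close>). These give the charts (\<open>C1_map_chart_inverse\<close>).

Injectivity of a matrix is an open condition, so the degree of the gcd is upper semicontinuous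
(\<open>openin_degree_gcd_le\<close>). This makes the domain of the parametrization and the set of coprime pairs open,
and it excludes that a stratum meets the closure of one with larger \<open>k\<close>. Conversely, adding a small constant to
one cofactor makes the cofactors coprime for all but finitely many constants, so a pair with gcd of
degree \<open>j\<close> is a limit of pairs with gcd of any smaller degree (\<open>gcd_pairs_subset_closure_of\<close>). Since pairs of exact
degrees are dense, so are the coprime ones.\<close>

section \<open>Scalar functions of class C1\<close>

text \<open>The scalar counterpart of \<^const>\<open>C1_map\<close>, as a property of the germ at \<open>x\<close>. Passing to germs
lets finitely many functions, each with a neighbourhood of its own, be combined by arithmetic.\<close>

definition C1_near ::
  "(complex \<Rightarrow> 'a \<Rightarrow> 'a) \<Rightarrow> 'a::real_normed_vector set \<Rightarrow> 'a \<Rightarrow> ('a \<Rightarrow> complex) \<Rightarrow> bool"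
  where "C1_near s V x f \<longleftrightarrow>
    (\<exists>U. \<exists>f' :: 'a \<Rightarrow> 'a \<Rightarrow>\<^sub>L complex. openin (top_of_set V) U \<and> x \<in> U \<and>
       (\<forall>y\<in>U. Vector_Spaces.linear s (*) (blinfun_apply (f' y)) \<and>
              (f has_derivative blinfun_apply (f' y)) (at y within V)) \<and>
       continuous_on U f')"

lemma vector_space_complex_mult: "vector_space ((*) :: complex \<Rightarrow> complex \<Rightarrow> complex)"
  by unfold_locales (auto simp: algebra_simps)

lemma has_derivative_openin_imp_continuous_on:
  fixes f' :: "'a::real_normed_vector \<Rightarrow> 'a \<Rightarrow>\<^sub>L 'b::real_normed_vector"
  assumes "\<And>y. y \<in> U \<Longrightarrow> (f has_derivative blinfun_apply (f' y)) (at y within V)" "U \<subseteq> V"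
  shows "continuous_on U f"
  using has_derivative_continuous[OF assms(1)] continuous_within_subset[OF _ assms(2)]
  by (auto simp: continuous_on_eq_continuous_within)

lemma C1_near_nonzero:
  assumes "C1_near s V x f" "f x \<noteq> 0"
  shows "\<exists>U. openin (top_of_set V) U \<and> x \<in> U \<and> (\<forall>y\<in>U. f y \<noteq> 0)"
proof -
  obtain U f' where U: "openin (top_of_set V) U" "x \<in> U"
    "\<And>y. y \<in> U \<Longrightarrow> (f has_derivative blinfun_apply (f' y)) (at y within V)"
    using assms(1) unfolding C1_near_def by metis
  have "continuous_on U f"
    using has_derivative_openin_imp_continuous_on[OF U(3) openin_imp_subset[OF U(1)]] by simp
  then have "openin (top_of_set U) (U \<inter> f -` (-{0}))"
    by (rule continuous_openin_preimage_gen) auto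
  then have "openin (top_of_set V) (U \<inter> f -` (-{0}))"
    using U(1) openin_trans by blast
  then show ?thesis
    using U(2) assms(2) by (intro exI[of _ "U \<inter> f -` (-{0})"]) auto
qed

lemma C1_near_linear:
  assumes "bounded_linear f" "Vector_Spaces.linear s (*) f" "x \<in> V"
  shows "C1_near s V x f"
  unfolding C1_near_def using assms
  by (intro exI[of _ V] exI[of _ "\<lambda>_. Blinfun f"])
    (auto simp: bounded_linear_Blinfun_apply intro: bounded_linear_imp_has_derivative)

lemma C1_near_const:
  assumes "vector_space s" "x \<in> V"
  shows "C1_near s V x (\<lambda>_. c)"
  unfolding C1_near_def using assms vector_space_complex_mult
  by (intro exI[of _ V] exI[of _ "\<lambda>_. 0"]) (auto simp: Vector_Spaces.linear_iff zero_blinfun.rep_eq)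

lemma C1_near_add:
  assumes "C1_near s V x f" "C1_near s V x g"
  shows "C1_near s V x (\<lambda>y. f y + g y)"
proof -
  obtain U f' where U: "openin (top_of_set V) U" "x \<in> U"
    "\<And>y. y \<in> U \<Longrightarrow> Vector_Spaces.linear s (*) (blinfun_apply (f' y))"
    "\<And>y. y \<in> U \<Longrightarrow> (f has_derivative blinfun_apply (f' y)) (at y within V)"
    "continuous_on U f'"
    using assms(1) unfolding C1_near_def by metis
  obtain W g' where W: "openin (top_of_set V) W" "x \<in> W"
    "\<And>y. y \<in> W \<Longrightarrow> Vector_Spaces.linear s (*) (blinfun_apply (g' y))"
    "\<And>y. y \<in> W \<Longrightarrow> (g has_derivative blinfun_apply (g' y)) (at y within V)"
    "continuous_on W g'"
    using assms(2) unfolding C1_near_def by metis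
  have "Vector_Spaces.linear s (*) (blinfun_apply (f' y + g' y))" if "y \<in> U \<inter> W" for y
    using U(3)[of y] W(3)[of y] that by (auto simp: Vector_Spaces.linear_iff blinfun.add_left algebra_simps)
  moreover have "((\<lambda>y. f y + g y) has_derivative blinfun_apply (f' y + g' y)) (at y within V)"
    if "y \<in> U \<inter> W" for y
    using U(4)[of y] W(4)[of y] that by (auto intro!: derivative_eq_intros simp: plus_blinfun.rep_eq)
  moreover have "continuous_on (U \<inter> W) (\<lambda>y. f' y + g' y)"
    using U(5) W(5) by (auto intro!: continuous_intros intro: continuous_on_subset)
  ultimately show ?thesis
    unfolding C1_near_def using U(1,2) W(1,2)
    by (intro exI[of _ "U \<inter> W"] exI[of _ "\<lambda>y. f' y + g' y"]) auto
qed

lemma C1_near_mult: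
  assumes "C1_near s V x f" "C1_near s V x g"
  shows "C1_near s V x (\<lambda>y. f y * g y)"
proof -
  obtain U f' where U: "openin (top_of_set V) U" "x \<in> U"
    "\<And>y. y \<in> U \<Longrightarrow> Vector_Spaces.linear s (*) (blinfun_apply (f' y))"
    "\<And>y. y \<in> U \<Longrightarrow> (f has_derivative blinfun_apply (f' y)) (at y within V)"
    "continuous_on U f'"
    using assms(1) unfolding C1_near_def by metis
  obtain W g' where W: "openin (top_of_set V) W" "x \<in> W"
    "\<And>y. y \<in> W \<Longrightarrow> Vector_Spaces.linear s (*) (blinfun_apply (g' y))"
    "\<And>y. y \<in> W \<Longrightarrow> (g has_derivative blinfun_apply (g' y)) (at y within V)"
    "continuous_on W g'"
    using assms(2) unfolding C1_near_def by metis
  define h' where "h' y = (blinfun_mult_right (f y) o\<^sub>L g' y) + (blinfun_mult_right (g y) o\<^sub>L f' y)" for y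
  have "Vector_Spaces.linear s (*) (blinfun_apply (h' y))" if "y \<in> U \<inter> W" for y
    using U(3)[of y] W(3)[of y] that
    by (auto simp: Vector_Spaces.linear_iff h'_def blinfun.add_left algebra_simps)
  moreover have "((\<lambda>y. f y * g y) has_derivative blinfun_apply (h' y)) (at y within V)"
    if "y \<in> U \<inter> W" for y
    using has_derivative_mult[OF U(4)[of y] W(4)[of y]] that
    by (auto simp: h'_def plus_blinfun.rep_eq mult.commute)
  moreover have "continuous_on (U \<inter> W) h'"
  proof -
    have "continuous_on U f"
      using has_derivative_openin_imp_continuous_on[OF U(4) openin_imp_subset[OF U(1)]] by simp
    moreover have "continuous_on W g"
      using has_derivative_openin_imp_continuous_on[OF W(4) openin_imp_subset[OF W(1)]] by simp
    ultimately have c: "continuous_on (U \<inter> W) f" "continuous_on (U \<inter> W) g"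
      "continuous_on (U \<inter> W) f'" "continuous_on (U \<inter> W) g'"
      using U(5) W(5) by (auto intro: continuous_on_subset)
    show ?thesis
      unfolding h'_def
      by (intro continuous_intros c bounded_linear.continuous_on[OF bounded_linear_blinfun_mult_right]
          bounded_bilinear.continuous_on[OF bounded_bilinear_blinfun_compose])
  qed
  ultimately show ?thesis
    unfolding C1_near_def using U(1,2) W(1,2)
    by (intro exI[of _ "U \<inter> W"] exI[of _ h']) auto
qed

lemma C1_near_inverse:
  assumes "C1_near s V x f" "f x \<noteq> 0"
  shows "C1_near s V x (\<lambda>y. inverse (f y))"
proof -
  obtain U f' where U: "openin (top_of_set V) U" "x \<in> U"
    "\<And>y. y \<in> U \<Longrightarrow> Vector_Spaces.linear s (*) (blinfun_apply (f' y))"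
    "\<And>y. y \<in> U \<Longrightarrow> (f has_derivative blinfun_apply (f' y)) (at y within V)"
    "continuous_on U f'"
    using assms(1) unfolding C1_near_def by metis
  obtain W where W: "openin (top_of_set V) W" "x \<in> W" "\<And>y. y \<in> W \<Longrightarrow> f y \<noteq> 0"
    using C1_near_nonzero[OF assms] by blast
  define h' where "h' y = blinfun_mult_right (- (inverse (f y) * inverse (f y))) o\<^sub>L f' y" for y
  have "Vector_Spaces.linear s (*) (blinfun_apply (h' y))" if "y \<in> U \<inter> W" for y
    using U(3)[of y] that by (auto simp: Vector_Spaces.linear_iff h'_def algebra_simps)
  moreover have "((\<lambda>y. inverse (f y)) has_derivative blinfun_apply (h' y)) (at y within V)"
    if "y \<in> U \<inter> W" for y
  proof -
    have "blinfun_apply (h' y) = (\<lambda>h. - (inverse (f y) * blinfun_apply (f' y) h * inverse (f y)))"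
      by (auto simp: h'_def)
    then show ?thesis
      using Deriv.has_derivative_inverse[OF W(3)[of y] U(4)[of y]] that by simp
  qed
  moreover have "continuous_on (U \<inter> W) h'"
  proof -
    have "continuous_on U f"
      using has_derivative_openin_imp_continuous_on[OF U(4) openin_imp_subset[OF U(1)]] by simp
    then have c: "continuous_on (U \<inter> W) f" "continuous_on (U \<inter> W) f'"
      using U(5) by (auto intro: continuous_on_subset)
    show ?thesis
      unfolding h'_def using W(3)
      by (intro continuous_intros c bounded_linear.continuous_on[OF bounded_linear_blinfun_mult_right]
          bounded_bilinear.continuous_on[OF bounded_bilinear_blinfun_compose]) auto
  qed
  ultimately show ?thesis
    unfolding C1_near_def using U(1,2) W(1,2)
    by (intro exI[of _ "U \<inter> W"] exI[of _ h']) auto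
qed

lemma C1_near_diff:
  assumes "vector_space s" "x \<in> V" "C1_near s V x f" "C1_near s V x g"
  shows "C1_near s V x (\<lambda>y. f y - g y)"
  using C1_near_add[OF assms(3) C1_near_mult[OF C1_near_const[OF assms(1,2), of "-1"] assms(4)]]
  by simp

lemma C1_near_sum:
  assumes "vector_space s" "x \<in> V" "\<And>i. i \<in> I \<Longrightarrow> C1_near s V x (f i)"
  shows "C1_near s V x (\<lambda>y. \<Sum>i\<in>I. f i y)"
proof (cases "finite I")
  case True
  then show ?thesis
    using assms(3)
  proof induction
    case (insert i I)
    then show ?case
      using C1_near_add[of s V x "f i" "\<lambda>y. \<Sum>i\<in>I. f i y"] by simp
  qed (simp add: C1_near_const[OF assms(1,2)])
qed (simp add: C1_near_const[OF assms(1,2)])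

section \<open>Linear systems with coefficients of class C1\<close>

text \<open>Injectivity at \<open>x\<close> provides a nonzero pivot for
each unknown in turn, the pivot stays nonzero near \<open>x\<close>, and so Gaussian elimination expresses every
unknown by sums, products and inverses of the coefficients. The system may have more equations than
unknowns and need not be solvable at a given point; then \<open>t\<close> is the only candidate for
a solution. With \<open>b = 0\<close> the result says that injectivity is an open condition.\<close>

lemma C1_near_linear_system:
  assumes s: "vector_space s" and x: "x \<in> V" and "finite J"
    and "\<And>i j. j \<in> J \<Longrightarrow> C1_near s V x (a i j)" and "\<And>i. C1_near s V x (b i)"
    and "\<And>z. (\<And>i. (\<Sum>j\<in>J. a i j x * z j) = 0) \<Longrightarrow> \<forall>j\<in>J. z j = 0"
  shows "\<exists>U t. openin (top_of_set V) U \<and> x \<in> U \<and> (\<forall>j\<in>J. C1_near s V x (t j)) \<and>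
    (\<forall>y\<in>U. \<forall>z. (\<forall>i. (\<Sum>j\<in>J. a i j y * z j) = b i y) \<longrightarrow> (\<forall>j\<in>J. z j = t j y))"
  using assms(3-)
proof (induction J arbitrary: a b rule: finite_induct)
  case empty
  then show ?case
    using x by (intro exI[of _ V]) auto
next
  case (insert j0 J)
  \<comment> \<open>If the column of the unknown \<open>j0\<close> vanished at \<open>x\<close>, the unit vector at \<open>j0\<close> would be in the kernel.\<close>
  obtain i0 where i0: "a i0 j0 x \<noteq> 0"
  proof (rule ccontr)
    assume "\<not> thesis"
    then have "a i j0 x = 0" for i
      using that by blast
    then have "(\<Sum>j\<in>insert j0 J. a i j x * (if j = j0 then 1 else 0)) = 0" for i
      using insert.hyps by (simp add: sum.neutral)
    then show False
      using insert.prems(3)[of "\<lambda>j. if j = j0 then 1 else 0"] by auto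
  qed
  define r where "r y = inverse (a i0 j0 y)" for y
  define a' where "a' i j y = a i j y - a i j0 y * r y * a i0 j y" for i j y
  define b' where "b' i y = b i y - a i j0 y * r y * b i0 y" for i y
  note C1 = C1_near_diff[OF s x] C1_near_mult C1_near_sum[OF s x]
  have r: "C1_near s V x r"
    unfolding r_def using insert.prems(1) i0 by (intro C1_near_inverse) auto
  obtain W where W: "openin (top_of_set V) W" "x \<in> W" "\<And>y. y \<in> W \<Longrightarrow> a i0 j0 y \<noteq> 0"
    using C1_near_nonzero[OF insert.prems(1) i0] by auto
  have "\<exists>U t. openin (top_of_set V) U \<and> x \<in> U \<and> (\<forall>j\<in>J. C1_near s V x (t j)) \<and>
    (\<forall>y\<in>U. \<forall>z. (\<forall>i. (\<Sum>j\<in>J. a' i j y * z j) = b' i y) \<longrightarrow> (\<forall>j\<in>J. z j = t j y))"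
  proof (rule insert.IH)
    show "C1_near s V x (a' i j)" if "j \<in> J" for i j
      unfolding a'_def using that insert.prems(1) r by (intro C1) auto
    show "C1_near s V x (b' i)" for i
      unfolding b'_def using insert.prems(1,2) r by (intro C1) auto
    fix z
    assume z: "\<And>i. (\<Sum>j\<in>J. a' i j x * z j) = 0"
    \<comment> \<open>A kernel vector of the reduced system extends to one of the original system.\<close>
    define z' where "z' = z(j0 := - r x * (\<Sum>j\<in>J. a i0 j x * z j))"
    have "(\<Sum>j\<in>insert j0 J. a i j x * z' j) = (\<Sum>j\<in>J. a' i j x * z j)" for i
    proof -
      have "(\<Sum>j\<in>J. a i j x * z' j) = (\<Sum>j\<in>J. a i j x * z j)"
        using insert.hyps by (intro sum.cong) (auto simp: z'_def)
      then have "(\<Sum>j\<in>insert j0 J. a i j x * z' j) = a i j0 x * z' j0 + (\<Sum>j\<in>J. a i j x * z j)"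
        using insert.hyps by simp
      also have "\<dots> = (\<Sum>j\<in>J. a i j x * z j) - a i j0 x * r x * (\<Sum>j\<in>J. a i0 j x * z j)"
        by (simp add: z'_def)
      also have "\<dots> = (\<Sum>j\<in>J. a' i j x * z j)"
        by (simp add: a'_def left_diff_distrib sum_subtractf sum_distrib_left mult.assoc)
      finally show ?thesis .
    qed
    then have "\<forall>j\<in>insert j0 J. z' j = 0"
      using z by (intro insert.prems(3)) auto
    moreover have "z' j = z j" if "j \<in> J" for j
      using insert.hyps that by (auto simp: z'_def)
    ultimately show "\<forall>j\<in>J. z j = 0"
      by simp
  qed
  then obtain U t where U: "openin (top_of_set V) U" "x \<in> U" "\<forall>j\<in>J. C1_near s V x (t j)"
    "\<forall>y\<in>U. \<forall>z. (\<forall>i. (\<Sum>j\<in>J. a' i j y * z j) = b' i y) \<longrightarrow> (\<forall>j\<in>J. z j = t j y)"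
    by (elim exE conjE) (rule that)
  define t' where "t' = t(j0 := \<lambda>y. r y * (b i0 y - (\<Sum>j\<in>J. a i0 j y * t j y)))"
  have "C1_near s V x (t' j)" if "j \<in> insert j0 J" for j
  proof (cases "j = j0")
    case True
    have "C1_near s V x (\<lambda>y. r y * (b i0 y - (\<Sum>j\<in>J. a i0 j y * t j y)))"
      using r insert.prems(1,2) U(3) by (intro C1) auto
    then show ?thesis
      by (simp add: t'_def True)
  qed (use that U(3) in \<open>auto simp: t'_def\<close>)
  moreover have "z j = t' j y" if y: "y \<in> U \<inter> W"
    and z: "\<And>i. (\<Sum>j\<in>insert j0 J. a i j y * z j) = b i y" and j: "j \<in> insert j0 J" for y z j
  proof -
    have ry: "a i0 j0 y * r y = 1"
      using W(3) y by (simp add: r_def)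
    have eq: "(\<Sum>j\<in>J. a i j y * z j) = b i y - a i j0 y * z j0" for i
      using z[of i] insert.hyps by (simp add: eq_diff_eq add.commute)
    have "(\<Sum>j\<in>J. a' i j y * z j) = b' i y" for i
    proof -
      have "(\<Sum>j\<in>J. a' i j y * z j)
          = (\<Sum>j\<in>J. a i j y * z j) - a i j0 y * r y * (\<Sum>j\<in>J. a i0 j y * z j)"
        by (simp add: a'_def left_diff_distrib sum_subtractf sum_distrib_left mult.assoc)
      also have "\<dots> = (b i y - a i j0 y * z j0) - a i j0 y * r y * (b i0 y - a i0 j0 y * z j0)"
        by (simp only: eq)
      also have "\<dots> = b' i y"
        using ry by (simp add: b'_def algebra_simps)
      finally show ?thesis .
    qed
    then have J: "z j = t j y" if "j \<in> J" for j
      using U(4) y that by blast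
    have "(\<Sum>j\<in>J. a i0 j y * t j y) = (\<Sum>j\<in>J. a i0 j y * z j)"
      using J by (intro sum.cong) auto
    then have "b i0 y - (\<Sum>j\<in>J. a i0 j y * t j y) = a i0 j0 y * z j0"
      by (simp only: eq) simp
    then have "z j0 = r y * (b i0 y - (\<Sum>j\<in>J. a i0 j y * t j y))"
      using ry by (simp only: mult.assoc[symmetric] mult.commute[of "r y"]) simp
    then show ?thesis
      using J j insert.hyps by (auto simp: t'_def)
  qed
  ultimately show ?case
    using U(1,2) W(1,2) by (intro exI[of _ "U \<inter> W"] exI[of _ t']) blast
qed

section \<open>Assembling maps from scalar components\<close>

lemma linear_sum_blinfun:
  fixes F :: "'i \<Rightarrow> 'a::real_normed_vector \<Rightarrow>\<^sub>L 'b::real_normed_vector"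
  assumes "vector_space sV" "vector_space sW"
    and "\<And>i. i \<in> I \<Longrightarrow> Vector_Spaces.linear sV sW (blinfun_apply (F i))"
  shows "Vector_Spaces.linear sV sW (blinfun_apply (\<Sum>i\<in>I. F i))"
proof (cases "finite I")
  case True
  interpret W: vector_space sW by fact
  show ?thesis
    using True assms
    by (induction I) (auto simp: Vector_Spaces.linear_iff blinfun.add_left blinfun.bilinear_simps algebra_simps W.scale_right_distrib)
next
  case False
  interpret W: vector_space sW by fact
  show ?thesis
    using False assms by (auto simp: Vector_Spaces.linear_iff)
qed

text \<open>Both ambient spaces of a chart are spanned by finitely many vectors \<open>e i\<close>, and the local extensions
that \<^const>\<open>C1_map\<close> asks for are found one coefficient at a time.\<close>

lemma C1_mapI_components:
  fixes e :: "'i \<Rightarrow> 'b::real_normed_vector" and V :: "'a::real_normed_vector set"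
  assumes sV: "vector_space sV" and sW: "vector_space sW"
    and bl: "\<And>i. i \<in> I \<Longrightarrow> bounded_linear (\<lambda>c. sW c (e i))"
    and W: "\<And>c. (\<Sum>i\<in>I. sW (c i) (e i)) \<in> W"
    and loc: "\<And>x. x \<in> S \<Longrightarrow> \<exists>U \<phi>. openin (top_of_set V) U \<and> x \<in> U \<and>
      (\<forall>i\<in>I. C1_near sV V x (\<phi> i)) \<and> (\<forall>y\<in>S \<inter> U. f y = (\<Sum>i\<in>I. sW (\<phi> i y) (e i)))"
    and fin: "finite I"
  shows "C1_map sV V sW W S f"
  unfolding C1_map_def
proof
  fix x assume "x \<in> S"
  from loc[OF this] obtain U \<phi> where U: "openin (top_of_set V) U" "x \<in> U"
    "\<forall>i\<in>I. C1_near sV V x (\<phi> i)"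
    "\<forall>y\<in>S \<inter> U. f y = (\<Sum>i\<in>I. sW (\<phi> i y) (e i))"
    by (elim exE conjE) (rule that)
  have "\<forall>i\<in>I. \<exists>A. \<exists>f' :: 'a \<Rightarrow> 'a \<Rightarrow>\<^sub>L complex. openin (top_of_set V) A \<and> x \<in> A \<and>
       (\<forall>y\<in>A. Vector_Spaces.linear sV (*) (blinfun_apply (f' y)) \<and>
              (\<phi> i has_derivative blinfun_apply (f' y)) (at y within V)) \<and>
       continuous_on A f'"
    using U(3) unfolding C1_near_def by blast
  then obtain A and \<phi>' :: "'i \<Rightarrow> 'a \<Rightarrow> 'a \<Rightarrow>\<^sub>L complex" where A: "\<And>i. i \<in> I \<Longrightarrow> openin (top_of_set V) (A i)" "\<And>i. i \<in> I \<Longrightarrow> x \<in> A i"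
    "\<And>i y. i \<in> I \<Longrightarrow> y \<in> A i \<Longrightarrow> Vector_Spaces.linear sV (*) (blinfun_apply (\<phi>' i y))"
    "\<And>i y. i \<in> I \<Longrightarrow> y \<in> A i \<Longrightarrow> (\<phi> i has_derivative blinfun_apply (\<phi>' i y)) (at y within V)"
    "\<And>i. i \<in> I \<Longrightarrow> continuous_on (A i) (\<phi>' i :: _ \<Rightarrow> _ \<Rightarrow>\<^sub>L complex)"
    unfolding bchoice_iff by blast
  define B where "B = U \<inter> (\<Inter>i\<in>I. A i)"
  define F where "F y = (\<Sum>i\<in>I. sW (\<phi> i y) (e i))" for y
  define F' where "F' y = (\<Sum>i\<in>I. Blinfun (\<lambda>c. sW c (e i)) o\<^sub>L \<phi>' i y)" for y
  have B: "openin (top_of_set V) B" "x \<in> B"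
    unfolding B_def using fin U(1,2) A(1,2)
    by (cases "I = {}"; auto intro!: openin_Int openin_INT2)+
  have ap: "blinfun_apply (Blinfun (\<lambda>c. sW c (e i))) = (\<lambda>c. sW c (e i))" if "i \<in> I" for i
    using bl[OF that] by (rule bounded_linear_Blinfun_apply)
  interpret W: vector_space sW by fact
  have "Vector_Spaces.linear sV sW (blinfun_apply (F' y))" if "y \<in> B" for y
    unfolding F'_def
  proof (rule linear_sum_blinfun[OF sV sW])
    fix i assume i: "i \<in> I"
    have "Vector_Spaces.linear sV (*) (blinfun_apply (\<phi>' i y))"
      using A(3)[OF i] that i by (auto simp: B_def)
    then show "Vector_Spaces.linear sV sW (blinfun_apply (Blinfun (\<lambda>c. sW c (e i)) o\<^sub>L \<phi>' i y))"
      using sW by (auto simp: Vector_Spaces.linear_iff ap[OF i] W.scale_left_distrib)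
  qed
  moreover have "(F has_derivative blinfun_apply (F' y)) (at y within V)" if "y \<in> B" for y
  proof -
    have "((\<lambda>y. \<Sum>i\<in>I. sW (\<phi> i y) (e i)) has_derivative (\<lambda>v. \<Sum>i\<in>I. sW (\<phi>' i y v) (e i))) (at y within V)"
      using that A(4) bl
      by (intro has_derivative_sum) (auto simp: B_def intro!: bounded_linear.has_derivative[where f="\<lambda>c. sW c _"])
    moreover have "(\<lambda>v. \<Sum>i\<in>I. sW (\<phi>' i y v) (e i)) = blinfun_apply (F' y)"
      by (auto simp: F'_def blinfun.sum_left ap)
    ultimately show ?thesis
      by (simp add: F_def[abs_def])
  qed
  moreover have "continuous_on B F'"
    unfolding F'_def using A(5)
    by (intro continuous_on_sum bounded_bilinear.continuous_on[OF bounded_bilinear_blinfun_compose] continuous_on_const)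
      (auto simp: B_def intro: continuous_on_subset)
  ultimately show "\<exists>U F. \<exists>F' :: _ \<Rightarrow> _ \<Rightarrow>\<^sub>L _. openin (top_of_set V) U \<and> x \<in> U \<and> F ` U \<subseteq> W \<and> (\<forall>y\<in>S \<inter> U. F y = f y) \<and>
       (\<forall>y\<in>U. Vector_Spaces.linear sV sW (blinfun_apply (F' y)) \<and>
              (F has_derivative blinfun_apply (F' y)) (at y within V)) \<and>
       continuous_on U F'"
    using B U(4) W by (intro exI[of _ B] exI[of _ F] exI[of _ F']) (auto simp: F_def B_def)
qed

section \<open>Degree of the gcd and syzygies\<close>

definition cpoly :: "nat \<Rightarrow> (nat \<Rightarrow> complex) \<Rightarrow> complex poly"
  where "cpoly N c = (\<Sum>i<N. monom (c i) i)"

lemma coeff_cpoly: "coeff (cpoly N c) i = (if i < N then c i else 0)"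
  by (simp add: cpoly_def coeff_sum)

lemma cpoly_eq_0_iff: "cpoly N c = 0 \<longleftrightarrow> (\<forall>i<N. c i = 0)"
  by (auto simp: poly_eq_iff coeff_cpoly)

lemma degree_cpoly_le: "degree (cpoly N c) \<le> N - 1"
  by (rule degree_le) (auto simp: coeff_cpoly)

lemma cpoly_coeff:
  assumes "degree p < N"
  shows "cpoly N (coeff p) = p"
  using assms by (auto simp: poly_eq_iff coeff_cpoly coeff_eq_0)

text \<open>The matrix of multiplication by the polynomial with coefficients \<open>c\<close>, in the monomial basis: a lower
triangular Toeplitz matrix, with rows for all coefficients of the product.\<close>

definition mult_matrix :: "(nat \<Rightarrow> complex) \<Rightarrow> nat \<Rightarrow> nat \<Rightarrow> complex"
  where "mult_matrix c i j = (if j \<le> i then c (i - j) else 0)"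

lemma coeff_mult_monom_mult_matrix: "coeff (p * monom a j) i = mult_matrix (coeff p) i j * a"
  by (subst mult.commute) (simp add: coeff_monom_mult mult_matrix_def)

lemma coeff_mult_cpoly:
  "coeff (p * cpoly N c) i = (\<Sum>j<N. mult_matrix (coeff p) i j * c j)"
  by (simp add: cpoly_def sum_distrib_left coeff_sum coeff_mult_monom_mult_matrix)

text \<open>The matrix of \<open>(\<beta>, \<alpha>) \<mapsto> p * \<beta> - q * \<alpha>\<close>, with the coefficients of \<open>\<beta>\<close> at \<open>Inl\<close> and
those of \<open>\<alpha>\<close> at \<open>Inr\<close>. Its restrictions to unknowns of bounded degree are the Sylvester
(subresultant) matrices of \<open>p\<close> and \<open>q\<close>.\<close>

definition syzygy_matrix ::
  "complex poly \<Rightarrow> complex poly \<Rightarrow> nat \<Rightarrow> nat + nat \<Rightarrow> complex"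
  where "syzygy_matrix p q i l =
    (case l of Inl j \<Rightarrow> mult_matrix (coeff p) i j | Inr j \<Rightarrow> - mult_matrix (coeff q) i j)"

lemma sum_syzygy_matrix:
  "(\<Sum>l\<in>{..<a} <+> {..<b}. syzygy_matrix p q i l * z l) =
    coeff (p * cpoly a (z \<circ> Inl) - q * cpoly b (z \<circ> Inr)) i"
  by (simp add: sum.Plus syzygy_matrix_def coeff_mult_cpoly sum_negf)

text \<open>Dividing \<open>p * \<beta> = q * \<alpha>\<close> by the gcd gives \<open>v * \<beta> = w * \<alpha>\<close> with coprime cofactors \<open>v\<close> and \<open>w\<close>, so
\<open>v\<close> divides \<open>\<alpha>\<close>. If the gcd has degree at most \<open>j\<close>, then \<open>v\<close> has degree at least \<open>m - j\<close>, more than a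
nonzero \<open>\<alpha>\<close> can have. Otherwise \<open>(w, v)\<close> itself is a nontrivial syzygy of the allowed degrees.
The condition on the gcd thus becomes the injectivity of a matrix linear in \<open>p\<close> and \<open>q\<close>.\<close>

lemma degree_gcd_le_iff_syzygy_trivial:
  fixes p q :: "complex poly"
  assumes p: "p \<noteq> 0" "degree p = m" and q: "q \<noteq> 0" "degree q = n"
  shows "degree (gcd p q) \<le> j \<longleftrightarrow>
    (\<forall>z. (\<forall>i. (\<Sum>l\<in>{..<n - j} <+> {..<m - j}. syzygy_matrix p q i l * z l) = 0) \<longrightarrow>
      (\<forall>l\<in>{..<n - j} <+> {..<m - j}. z l = 0))" (is "_ = ?trivial")
proof -
  define g where "g = gcd p q"
  define v where "v = p div g"
  define w where "w = q div g"
  have g0: "g \<noteq> 0"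
    using p(1) by (simp add: g_def)
  have pv: "p = g * v" and qw: "q = g * w"
    by (simp_all add: v_def w_def g_def)
  have vw: "v \<noteq> 0" "w \<noteq> 0"
    using p(1) q(1) pv qw by auto
  have deg: "degree p = degree g + degree v" "degree q = degree g + degree w"
    using pv qw g0 vw degree_mult_eq by metis+
  have cop: "coprime v w"
    unfolding v_def w_def g_def using p(1) by (intro div_gcd_coprime) auto
  have eq0: "(\<forall>i. (\<Sum>l\<in>{..<n - j} <+> {..<m - j}. syzygy_matrix p q i l * z l) = 0) \<longleftrightarrow>
      v * cpoly (n - j) (z \<circ> Inl) = w * cpoly (m - j) (z \<circ> Inr)" for z
  proof -
    have "(\<forall>i. (\<Sum>l\<in>{..<n - j} <+> {..<m - j}. syzygy_matrix p q i l * z l) = 0) \<longleftrightarrow>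
        p * cpoly (n - j) (z \<circ> Inl) = q * cpoly (m - j) (z \<circ> Inr)"
      by (auto simp: sum_syzygy_matrix poly_eq_iff)
    also have "\<dots> \<longleftrightarrow> g * (v * cpoly (n - j) (z \<circ> Inl)) = g * (w * cpoly (m - j) (z \<circ> Inr))"
      by (simp only: pv qw mult.assoc)
    finally show ?thesis
      using g0 by simp
  qed
  show ?thesis
  proof
    assume le: "degree (gcd p q) \<le> j"
    show ?trivial
    proof (intro allI impI)
      fix z :: "nat + nat \<Rightarrow> complex"
      define \<alpha> where "\<alpha> = cpoly (m - j) (z \<circ> Inr)"
      define \<beta> where "\<beta> = cpoly (n - j) (z \<circ> Inl)"
      assume "\<forall>i. (\<Sum>l\<in>{..<n - j} <+> {..<m - j}. syzygy_matrix p q i l * z l) = 0"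
      then have eq: "v * \<beta> = w * \<alpha>"
        unfolding eq0 \<alpha>_def \<beta>_def .
      have "v dvd \<alpha>"
        using eq cop coprime_dvd_mult_right_iff[of v w \<alpha>] by (metis dvd_triv_left)
      have "\<alpha> = 0"
      proof (rule ccontr)
        assume "\<alpha> \<noteq> 0"
        then have "degree v \<le> degree \<alpha>"
          using \<open>v dvd \<alpha>\<close> by (simp add: dvd_imp_degree_le)
        moreover have "m - j \<noteq> 0"
          using \<open>\<alpha> \<noteq> 0\<close> by (auto simp: \<alpha>_def cpoly_def)
        ultimately show False
          using degree_cpoly_le[of "m - j" "z \<circ> Inr"] le deg p(2) by (simp add: \<alpha>_def g_def)
      qed
      then have "\<beta> = 0"
        using eq vw by simp
      with \<open>\<alpha> = 0\<close> show "\<forall>l\<in>{..<n - j} <+> {..<m - j}. z l = 0"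
        by (auto simp: \<alpha>_def \<beta>_def cpoly_eq_0_iff)
    qed
  next
    assume triv: ?trivial
    show "degree (gcd p q) \<le> j"
    proof (rule ccontr)
      assume "\<not> degree (gcd p q) \<le> j"
      then have lt: "degree v < m - j" "degree w < n - j"
        using deg p(2) q(2) by (auto simp: g_def)
      define z where "z = case_sum (coeff w) (coeff v)"
      have z: "cpoly (n - j) (z \<circ> Inl) = w" "cpoly (m - j) (z \<circ> Inr) = v"
        using lt by (simp_all add: z_def case_sum_o_inj cpoly_coeff)
      then have "\<forall>l\<in>{..<n - j} <+> {..<m - j}. z l = 0"
        using triv[unfolded eq0] by (simp add: mult.commute)
      then have "v = 0"
        unfolding z(2)[symmetric] cpoly_eq_0_iff by auto
      then show False
        using vw by simp
    qed
  qed
qed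

lemma all_GCD_degree_iff:
  fixes p q :: "complex poly"
  assumes "p \<noteq> 0"
  shows "(\<forall>g. is_GCD g p q \<longrightarrow> degree g = k) \<longleftrightarrow> degree (gcd p q) = k"
proof -
  have "gcd p q \<noteq> 0"
    using assms by simp
  then have "is_GCD (gcd p q) p q"
    unfolding is_GCD_def by (auto intro: dvd_imp_degree_le)
  moreover from this have "degree g = degree (gcd p q)" if "is_GCD g p q" for g
    using that unfolding is_GCD_def by (meson le_antisym)
  ultimately show ?thesis
    by metis
qed

abbreviation degree_gcd :: "npoly \<times> npoly \<Rightarrow> nat"
  where "degree_gcd x \<equiv> degree (gcd (poly_of (fst x)) (poly_of (snd x)))"

lemma poly_of_eq_0_iff: "poly_of p = 0 \<longleftrightarrow> p = 0"
  by (simp add: poly_of_inject[symmetric] zero_npoly.rep_eq)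

lemma mem_poly_pairs:
  "x \<in> poly_pairs m n \<longleftrightarrow> degree (poly_of (fst x)) \<le> m \<and> degree (poly_of (snd x)) \<le> n"
  by (cases x) (simp add: poly_pairs_def polys_def)

lemma mem_exact_pairs:
  "x \<in> exact_pairs m n \<longleftrightarrow> x \<in> poly_pairs m n \<and>
    coeff (poly_of (fst x)) m \<noteq> 0 \<and> coeff (poly_of (snd x)) n \<noteq> 0"
proof -
  have "p \<noteq> 0 \<and> degree (poly_of p) = N \<longleftrightarrow> degree (poly_of p) \<le> N \<and> coeff (poly_of p) N \<noteq> 0" for p N
    using le_degree[of "poly_of p" N] leading_coeff_0_iff[of "poly_of p"]
    by (auto simp: poly_of_eq_0_iff[symmetric])
  then show ?thesis
    by (cases x) (auto simp: exact_pairs_def mem_poly_pairs)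
qed

lemma exact_pairsD:
  assumes "x \<in> exact_pairs m n"
  shows "poly_of (fst x) \<noteq> 0" "degree (poly_of (fst x)) = m"
    "poly_of (snd x) \<noteq> 0" "degree (poly_of (snd x)) = n"
  using assms by (cases x; simp add: exact_pairs_def poly_of_eq_0_iff)+

lemma mem_gcd_pairs:
  "x \<in> gcd_pairs m n k \<longleftrightarrow> x \<in> exact_pairs m n \<and> degree_gcd x = k"
proof -
  have "x \<in> gcd_pairs m n k \<longleftrightarrow> x \<in> exact_pairs m n \<and>
      (\<forall>g. is_GCD g (poly_of (fst x)) (poly_of (snd x)) \<longrightarrow> degree g = k)"
    by (cases x) (simp add: gcd_pairs_def)
  then show ?thesis
    using all_GCD_degree_iff[OF exact_pairsD(1)[of x m n]] by blast
qed

section \<open>Semicontinuity of the degree of the gcd\<close>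

lemma norm_coeff_le: "norm (coeff (poly_of p) i) \<le> norm p"
proof (cases "i \<le> degree (poly_of p)")
  case True
  then show ?thesis
    unfolding norm_npoly.rep_eq by (intro member_le_L2_set) auto
qed (simp add: coeff_eq_0)

lemma C1_near_coeff_fst:
  assumes "x \<in> V"
  shows "C1_near scale_pair V x (\<lambda>y. coeff (poly_of (fst y)) i)"
proof (rule C1_near_linear[OF _ _ assms])
  show "bounded_linear (\<lambda>y :: npoly \<times> npoly. coeff (poly_of (fst y)) i)"
  proof (rule bounded_linear_intro[where K = 1])
    show "norm (coeff (poly_of (fst y)) i) \<le> norm y * 1" for y :: "npoly \<times> npoly"
      using norm_coeff_le[of "fst y" i] norm_fst_le[of "fst y" "snd y"] by simp
  qed (simp_all add: plus_npoly.rep_eq scaleR_npoly.rep_eq scaleR_conv_of_real)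
  show "Vector_Spaces.linear scale_pair (*) (\<lambda>y. coeff (poly_of (fst y)) i)"
    by (simp add: Vector_Spaces.linear_iff vector_space_scale_pair vector_space_complex_mult
        plus_npoly.rep_eq scale_pair_def scale_npoly.rep_eq)
qed

lemma C1_near_coeff_snd:
  assumes "x \<in> V"
  shows "C1_near scale_pair V x (\<lambda>y. coeff (poly_of (snd y)) i)"
proof (rule C1_near_linear[OF _ _ assms])
  show "bounded_linear (\<lambda>y :: npoly \<times> npoly. coeff (poly_of (snd y)) i)"
  proof (rule bounded_linear_intro[where K = 1])
    show "norm (coeff (poly_of (snd y)) i) \<le> norm y * 1" for y :: "npoly \<times> npoly"
      using norm_coeff_le[of "snd y" i] norm_snd_le[of "snd y" "fst y"] by simp
  qed (simp_all add: plus_npoly.rep_eq scaleR_npoly.rep_eq scaleR_conv_of_real)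
  show "Vector_Spaces.linear scale_pair (*) (\<lambda>y. coeff (poly_of (snd y)) i)"
    by (simp add: Vector_Spaces.linear_iff vector_space_scale_pair vector_space_complex_mult
        plus_npoly.rep_eq scale_pair_def scale_npoly.rep_eq)
qed

lemma C1_near_mult_matrix:
  assumes "vector_space s" "x \<in> V" "\<And>l. C1_near s V x (\<lambda>y. c y l)"
  shows "C1_near s V x (\<lambda>y. mult_matrix (c y) i j)"
  using assms C1_near_const[OF assms(1,2)] by (cases "j \<le> i") (simp_all add: mult_matrix_def)

lemma C1_near_syzygy_matrix:
  assumes "x \<in> V"
  shows "C1_near scale_pair V x (\<lambda>y. syzygy_matrix (poly_of (fst y)) (poly_of (snd y)) i l)"
proof (cases l)
  case (Inl j)
  then show ?thesis
    using C1_near_mult_matrix[OF vector_space_scale_pair assms C1_near_coeff_fst[OF assms]]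
    by (simp add: syzygy_matrix_def)
next
  case (Inr j)
  have "C1_near scale_pair V x (\<lambda>y. 0 - mult_matrix (coeff (poly_of (snd y))) i j)"
    by (intro C1_near_diff[OF vector_space_scale_pair assms] C1_near_const[OF vector_space_scale_pair assms]
        C1_near_mult_matrix[OF vector_space_scale_pair assms C1_near_coeff_snd[OF assms]])
  then show ?thesis
    by (simp add: syzygy_matrix_def Inr)
qed

text \<open>Injectivity of the matrix of syzygies persists near a point where it holds: the unique
candidate solution of the homogeneous system that elimination provides is the zero vector.\<close>

lemma openin_degree_gcd_le:
  "openin (top_of_set (poly_pairs m n)) {x \<in> exact_pairs m n. degree_gcd x \<le> j}"
proof (subst openin_subopen, intro ballI)
  fix x assume "x \<in> {x \<in> exact_pairs m n. degree_gcd x \<le> j}"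
  then have x: "x \<in> exact_pairs m n" "degree_gcd x \<le> j"
    by auto
  then have xV: "x \<in> poly_pairs m n" and nz: "coeff (poly_of (fst x)) m \<noteq> 0" "coeff (poly_of (snd x)) n \<noteq> 0"
    by (auto simp: mem_exact_pairs)
  let ?J = "{..<n - j} <+> {..<m - j}"
  let ?a = "\<lambda>i l y. syzygy_matrix (poly_of (fst y)) (poly_of (snd y)) i l"
  have triv: "\<forall>z. (\<forall>i. (\<Sum>l\<in>?J. ?a i l x * z l) = 0) \<longrightarrow> (\<forall>l\<in>?J. z l = 0)"
    using x(2) by (simp only: degree_gcd_le_iff_syzygy_trivial[OF exact_pairsD[OF x(1)], of j])
  have "\<exists>U t. openin (top_of_set (poly_pairs m n)) U \<and> x \<in> U \<and>
    (\<forall>l\<in>?J. C1_near scale_pair (poly_pairs m n) x (t l)) \<and>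
    (\<forall>y\<in>U. \<forall>z. (\<forall>i. (\<Sum>l\<in>?J. ?a i l y * z l) = (\<lambda>_ _. 0) i y) \<longrightarrow> (\<forall>l\<in>?J. z l = t l y))"
    using triv by (intro C1_near_linear_system vector_space_scale_pair xV C1_near_syzygy_matrix
        C1_near_const[OF vector_space_scale_pair xV]) auto
  then obtain U t where U: "openin (top_of_set (poly_pairs m n)) U" "x \<in> U"
    and "\<forall>l\<in>?J. C1_near scale_pair (poly_pairs m n) x (t l)"
    and sol: "\<forall>y\<in>U. \<forall>z. (\<forall>i. (\<Sum>l\<in>?J. ?a i l y * z l) = 0) \<longrightarrow> (\<forall>l\<in>?J. z l = t l y)"
    by (elim exE conjE) (rule that)
  obtain W1 where W1: "openin (top_of_set (poly_pairs m n)) W1" "x \<in> W1"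
    "\<forall>y\<in>W1. coeff (poly_of (fst y)) m \<noteq> 0"
    using C1_near_nonzero[OF C1_near_coeff_fst[OF xV] nz(1)] by blast
  obtain W2 where W2: "openin (top_of_set (poly_pairs m n)) W2" "x \<in> W2"
    "\<forall>y\<in>W2. coeff (poly_of (snd y)) n \<noteq> 0"
    using C1_near_nonzero[OF C1_near_coeff_snd[OF xV] nz(2)] by blast
  have "y \<in> exact_pairs m n \<and> degree_gcd y \<le> j" if y: "y \<in> U \<inter> W1 \<inter> W2" for y
  proof -
    have ex: "y \<in> exact_pairs m n"
      using y W1 W2 openin_imp_subset[OF U(1)] by (auto simp: mem_exact_pairs)
    have sol_y: "\<forall>l\<in>?J. z l = t l y" if "\<forall>i. (\<Sum>l\<in>?J. ?a i l y * z l) = 0" for z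
      using sol y that by blast
    have "\<forall>l\<in>?J. t l y = 0"
      using sol_y[of "\<lambda>_. 0"] by simp
    then have "\<forall>z. (\<forall>i. (\<Sum>l\<in>?J. ?a i l y * z l) = 0) \<longrightarrow> (\<forall>l\<in>?J. z l = 0)"
      using sol_y by simp
    then have "degree_gcd y \<le> j"
      by (simp only: degree_gcd_le_iff_syzygy_trivial[OF exact_pairsD[OF ex], of j])
    with ex show ?thesis ..
  qed
  then show "\<exists>T. openin (top_of_set (poly_pairs m n)) T \<and> x \<in> T \<and>
      T \<subseteq> {x \<in> exact_pairs m n. degree_gcd x \<le> j}"
    using U(1,2) W1(1,2) W2(1,2) by (intro exI[of _ "U \<inter> W1 \<inter> W2"]) auto
qed

section \<open>Maps of class C1 into pairs of polynomials and into coordinate space\<close>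

lemma poly_of_sum: "poly_of (sum f I) = (\<Sum>i\<in>I. poly_of (f i))"
  by (induction I rule: infinite_finite_induct) (simp_all add: zero_npoly.rep_eq plus_npoly.rep_eq)

lemma norm_scale_npoly: "norm (scale_npoly c p) = norm c * norm p"
proof -
  have "degree (poly_of (scale_npoly c p)) \<le> degree (poly_of p)"
    by (simp add: scale_npoly.rep_eq degree_smult_le)
  from norm_npoly_bound[OF this] show ?thesis
    by (simp add: norm_npoly_bound[OF order_refl, of p] scale_npoly.rep_eq norm_mult
        L2_set_right_distrib)
qed

lemma scale_pair_scaleR: "scale_pair (r *\<^sub>R c) x = r *\<^sub>R scale_pair c x"
  by (simp add: scale_pair_def prod_eq_iff poly_of_inject[symmetric] scale_npoly.rep_eq
      scaleR_npoly.rep_eq scaleR_conv_of_real)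

lemma bounded_linear_scale_pair: "bounded_linear (\<lambda>c. scale_pair c x)"
proof (rule bounded_linear_intro)
  interpret P: vector_space scale_pair
    by (rule vector_space_scale_pair)
  show "scale_pair (c + d) x = scale_pair c x + scale_pair d x" for c d
    by (rule P.scale_left_distrib)
  show "norm (scale_pair c x) \<le> norm c * norm x" for c
    by (cases x) (simp add: scale_pair_def norm_scale_npoly norm_Pair power_mult_distrib
        real_sqrt_mult flip: distrib_left)
qed (rule scale_pair_scaleR)

lemma C1_map_into_poly_pairs:
  assumes s: "vector_space s"
    and sub: "S \<subseteq> V" "f ` S \<subseteq> poly_pairs m n"
    and C1: "\<And>x i. x \<in> S \<Longrightarrow> C1_near s V x (\<lambda>y. coeff (poly_of (fst (f y))) i)"
      "\<And>x i. x \<in> S \<Longrightarrow> C1_near s V x (\<lambda>y. coeff (poly_of (snd (f y))) i)"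
  shows "C1_map s V scale_pair (poly_pairs m n) S f"
proof -
  define e where "e = case_sum (\<lambda>i. (npoly_of (monom 1 i), 0)) (\<lambda>i. (0, npoly_of (monom 1 i)))"
  let ?I = "{..m} <+> {..n}"
  have fst_e: "poly_of (fst (\<Sum>i\<in>?I. scale_pair (c i) (e i))) = (\<Sum>i\<le>m. monom (c (Inl i)) i)"
    and snd_e: "poly_of (snd (\<Sum>i\<in>?I. scale_pair (c i) (e i))) = (\<Sum>i\<le>n. monom (c (Inr i)) i)" for c
    by (simp_all add: e_def sum.Plus fst_sum snd_sum poly_of_sum scale_pair_def scale_npoly.rep_eq
        zero_npoly.rep_eq plus_npoly.rep_eq smult_monom npoly_of_inverse)
  show ?thesis
  proof (rule C1_mapI_components[where I = ?I and e = e, OF s vector_space_scale_pair])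
    show "bounded_linear (\<lambda>c. scale_pair c (e i))" for i
      by (rule bounded_linear_scale_pair)
    show "(\<Sum>i\<in>?I. scale_pair (c i) (e i)) \<in> poly_pairs m n" for c
      by (auto simp: mem_poly_pairs fst_e snd_e intro!: degree_le simp: coeff_sum)
    fix x assume x: "x \<in> S"
    define \<phi> where "\<phi> = case_sum (\<lambda>i y. coeff (poly_of (fst (f y))) i) (\<lambda>i y. coeff (poly_of (snd (f y))) i)"
    have "f y = (\<Sum>i\<in>?I. scale_pair (\<phi> i y) (e i))" if "y \<in> S" for y
    proof -
      have "f y \<in> poly_pairs m n"
        using sub(2) that by blast
      then show ?thesis
        by (simp add: prod_eq_iff poly_of_inject[symmetric] fst_e snd_e \<phi>_def mem_poly_pairs
            poly_as_sum_of_monoms')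
    qed
    moreover have "\<forall>i\<in>?I. C1_near s V x (\<phi> i)"
      using C1[OF x] by (auto simp: \<phi>_def)
    moreover have "x \<in> V"
      using sub(1) x by blast
    ultimately show "\<exists>U \<phi>. openin (top_of_set V) U \<and> x \<in> U \<and> (\<forall>i\<in>?I. C1_near s V x (\<phi> i)) \<and>
        (\<forall>y\<in>S \<inter> U. f y = (\<Sum>i\<in>?I. scale_pair (\<phi> i y) (e i)))"
      by (intro exI[of _ V] exI[of _ \<phi>]) simp
  qed simp
qed

lemma norm_single: "norm (Poly_Mapping.single i c) = norm c" for c :: "'a::real_normed_vector"
  by (cases "c = 0") (simp_all add: norm_poly_mapping_def dist_poly_mapping_def)

lemma norm_lookup_le: "norm (Poly_Mapping.lookup z i) \<le> norm z" for z :: "'i \<Rightarrow>\<^sub>0 'a::real_normed_vector"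
proof (cases "i \<in> Poly_Mapping.keys z")
  case True
  then have "norm (Poly_Mapping.lookup z i) \<le> (\<Sum>i\<in>Poly_Mapping.keys z. norm (Poly_Mapping.lookup z i))"
    by (intro member_le_sum) auto
  then show ?thesis
    by (simp add: norm_poly_mapping_def dist_poly_mapping_def)
qed (simp add: in_keys_iff)

lemma lookup_scaleR: "Poly_Mapping.lookup (r *\<^sub>R x) i = r *\<^sub>R Poly_Mapping.lookup x i"
  for x :: "'i \<Rightarrow>\<^sub>0 'a::real_normed_vector"
proof -
  have "finite {i. r *\<^sub>R Poly_Mapping.lookup x i \<noteq> 0}"
    by (rule finite_subset[OF _ finite_keys[of x]]) (auto simp: in_keys_iff)
  then show ?thesis
    by (simp add: scaleR_poly_mapping_def Abs_poly_mapping_inverse)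
qed

lemma C1_near_lookup:
  assumes "x \<in> V"
  shows "C1_near scale_coord V x (\<lambda>z. Poly_Mapping.lookup z i)"
proof (rule C1_near_linear[OF _ _ assms])
  show "bounded_linear (\<lambda>z :: nat \<Rightarrow>\<^sub>0 complex. Poly_Mapping.lookup z i)"
    using norm_lookup_le
    by (intro bounded_linear_intro[where K = 1]) (simp_all add: lookup_add lookup_scaleR)
  show "Vector_Spaces.linear scale_coord (*) (\<lambda>z. Poly_Mapping.lookup z i)"
    by (simp add: Vector_Spaces.linear_iff vector_space_scale_coord vector_space_complex_mult lookup_add)
qed

lemma mem_coord_space: "z \<in> coord_space d \<longleftrightarrow> (\<forall>i\<ge>d. Poly_Mapping.lookup z i = 0)"
  unfolding coord_space_def in_keys_iff subset_iff by (auto simp: not_less[symmetric])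

lemma lookup_sum_scale_single:
  "Poly_Mapping.lookup (\<Sum>i<d. scale_coord (c i) (Poly_Mapping.single i 1)) j = (if j < d then c j else 0)"
  by (simp add: lookup_sum lookup_single when_def if_distrib cong: if_cong)

lemma C1_map_into_coord_space:
  assumes s: "vector_space s"
    and sub: "f ` S \<subseteq> coord_space d"
    and loc: "\<And>x. x \<in> S \<Longrightarrow> \<exists>U \<phi>. openin (top_of_set V) U \<and> x \<in> U \<and>
      (\<forall>i<d. C1_near s V x (\<phi> i)) \<and> (\<forall>y\<in>S \<inter> U. \<forall>i<d. Poly_Mapping.lookup (f y) i = \<phi> i y)"
  shows "C1_map s V scale_coord (coord_space d) S f"
proof (rule C1_mapI_components[where I = "{..<d}" and e = "\<lambda>i. Poly_Mapping.single i 1",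
    OF s vector_space_scale_coord])
  have single: "scale_coord c (Poly_Mapping.single i 1) = Poly_Mapping.single i c" for c i
    by (rule poly_mapping_eqI) (simp add: lookup_single when_def)
  show "bounded_linear (\<lambda>c. scale_coord c (Poly_Mapping.single i 1))" for i
    unfolding single
    by (intro bounded_linear_intro[where K = 1])
      (auto simp: norm_single single_add lookup_single when_def lookup_scaleR intro!: poly_mapping_eqI)
  show "(\<Sum>i<d. scale_coord (c i) (Poly_Mapping.single i 1)) \<in> coord_space d" for c
    by (simp add: mem_coord_space lookup_sum_scale_single)
  fix x assume "x \<in> S"
  from loc[OF this] obtain U \<phi> where U: "openin (top_of_set V) U" "x \<in> U"
    "\<forall>i<d. C1_near s V x (\<phi> i)" "\<forall>y\<in>S \<inter> U. \<forall>i<d. Poly_Mapping.lookup (f y) i = \<phi> i y"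
    by (elim exE conjE) (rule that)
  have "f y = (\<Sum>i<d. scale_coord (\<phi> i y) (Poly_Mapping.single i 1))" if "y \<in> S \<inter> U" for y
  proof (rule poly_mapping_eqI)
    have "f y \<in> coord_space d"
      using sub that by blast
    then show "Poly_Mapping.lookup (f y) j =
        Poly_Mapping.lookup (\<Sum>i<d. scale_coord (\<phi> i y) (Poly_Mapping.single i 1)) j" for j
      using U(4) that by (simp add: lookup_sum_scale_single mem_coord_space)
  qed
  then show "\<exists>U \<phi>. openin (top_of_set V) U \<and> x \<in> U \<and> (\<forall>i\<in>{..<d}. C1_near s V x (\<phi> i)) \<and>
      (\<forall>y\<in>S \<inter> U. f y = (\<Sum>i<d. scale_coord (\<phi> i y) (Poly_Mapping.single i 1)))"
    using U(1-3) by (intro exI[of _ U] exI[of _ \<phi>]) simp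
qed simp

lemma C1_map_imp_continuous_on:
  fixes V :: "'a::real_normed_vector set" and f :: "'a \<Rightarrow> 'b::real_normed_vector"
  assumes "C1_map sV V sW W V f"
  shows "continuous_on V f"
  unfolding continuous_on_eq_continuous_within
proof
  fix x assume "x \<in> V"
  from bspec[OF assms[unfolded C1_map_def] this]
  obtain U F and F' :: "'a \<Rightarrow> 'a \<Rightarrow>\<^sub>L 'b" where U: "openin (top_of_set V) U" "x \<in> U"
    "F ` U \<subseteq> W" "\<forall>y\<in>V \<inter> U. F y = f y"
    "\<forall>y\<in>U. Vector_Spaces.linear sV sW (blinfun_apply (F' y)) \<and>
              (F has_derivative blinfun_apply (F' y)) (at y within V)" "continuous_on U F'"
    by (elim exE conjE) (rule that)
  have "(F has_derivative blinfun_apply (F' x)) (at x within V)"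
    using U(2,5) by simp
  then have "continuous (at x within V) F"
    by (rule has_derivative_continuous)
  then show "continuous (at x within V) f"
    by (rule continuous_transform_within_openin[OF _ U(1,2)])
      (use U(4) openin_imp_subset[OF U(1)] in auto)
qed

section \<open>A global chart\<close>

text \<open>A point \<open>z\<close> of the coordinate space lists the \<open>k\<close> lower coefficients of a monic polynomial of degree
\<open>k\<close> (indices below \<open>k\<close>), then the \<open>m - k + 1\<close> coefficients of one cofactor (indices \<open>k\<close> to \<open>m\<close>) and the
\<open>n - k + 1\<close> coefficients of the other (indices from \<open>m + 1\<close>), in total \<open>m + n + 2 - k\<close> numbers. The
parametrization \<open>chart\<close> multiplies the monic factor into both cofactors.\<close>

definition chart_gcd :: "nat \<Rightarrow> (nat \<Rightarrow>\<^sub>0 complex) \<Rightarrow> complex poly"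
  where "chart_gcd k z = monom 1 k + cpoly k (Poly_Mapping.lookup z)"

definition chart_fst :: "nat \<Rightarrow> nat \<Rightarrow> (nat \<Rightarrow>\<^sub>0 complex) \<Rightarrow> complex poly"
  where "chart_fst m k z = cpoly (Suc (m - k)) (\<lambda>i. Poly_Mapping.lookup z (k + i))"

definition chart_snd :: "nat \<Rightarrow> nat \<Rightarrow> nat \<Rightarrow> (nat \<Rightarrow>\<^sub>0 complex) \<Rightarrow> complex poly"
  where "chart_snd m n k z = cpoly (Suc (n - k)) (\<lambda>i. Poly_Mapping.lookup z (Suc m + i))"

definition chart :: "nat \<Rightarrow> nat \<Rightarrow> nat \<Rightarrow> (nat \<Rightarrow>\<^sub>0 complex) \<Rightarrow> npoly \<times> npoly"
  where "chart m n k z =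
    (npoly_of (chart_gcd k z * chart_fst m k z), npoly_of (chart_gcd k z * chart_snd m n k z))"

definition chart_domain :: "nat \<Rightarrow> nat \<Rightarrow> nat \<Rightarrow> (nat \<Rightarrow>\<^sub>0 complex) set"
  where "chart_domain m n k = {z \<in> coord_space (m + n + 2 - k). chart m n k z \<in> gcd_pairs m n k}"

lemma poly_of_chart:
  "poly_of (fst (chart m n k z)) = chart_gcd k z * chart_fst m k z"
  "poly_of (snd (chart m n k z)) = chart_gcd k z * chart_snd m n k z"
  by (simp_all add: chart_def npoly_of_inverse)

lemma coeff_chart_gcd:
  "coeff (chart_gcd k z) i = (if i < k then Poly_Mapping.lookup z i else if i = k then 1 else 0)"
  by (simp add: chart_gcd_def coeff_cpoly)

lemma degree_chart_gcd: "degree (chart_gcd k z) = k"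
  by (rule antisym) (auto intro: degree_le le_degree simp: coeff_chart_gcd)

lemma chart_gcd_nonzero: "chart_gcd k z \<noteq> 0"
  using coeff_chart_gcd[of k z k] by auto

lemma lead_coeff_chart_gcd: "lead_coeff (chart_gcd k z) = 1"
  by (simp add: degree_chart_gcd coeff_chart_gcd)

lemma chart_in_poly_pairs:
  assumes "k \<le> m" "k \<le> n"
  shows "chart m n k z \<in> poly_pairs m n"
proof -
  have "degree (chart_gcd k z * cpoly (Suc (N - k)) c) \<le> N" if "k \<le> N" for N c
    using degree_mult_le[of "chart_gcd k z" "cpoly (Suc (N - k)) c"] degree_cpoly_le[of "Suc (N - k)" c] that
    by (simp add: degree_chart_gcd)
  then show ?thesis
    using assms by (simp add: mem_poly_pairs poly_of_chart chart_fst_def chart_snd_def)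
qed

lemma chart_cofactors:
  assumes "chart m n k z \<in> exact_pairs m n"
  shows "degree (chart_fst m k z) = m - k" "degree (chart_snd m n k z) = n - k"
    "coeff (chart_fst m k z) (m - k) = coeff (poly_of (fst (chart m n k z))) m"
    "coeff (chart_snd m n k z) (n - k) = coeff (poly_of (snd (chart m n k z))) n"
proof -
  have "degree v = N - k \<and> coeff v (N - k) = coeff (chart_gcd k z * v) N"
    if "chart_gcd k z * v \<noteq> 0" "degree (chart_gcd k z * v) = N" for v N
  proof -
    have "N = k + degree v"
      using that by (auto simp: degree_mult_eq degree_chart_gcd)
    then show ?thesis
      using lead_coeff_mult[of "chart_gcd k z" v] lead_coeff_chart_gcd[of k z] that(2) by simp
  qed
  then show "degree (chart_fst m k z) = m - k" "degree (chart_snd m n k z) = n - k"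
    "coeff (chart_fst m k z) (m - k) = coeff (poly_of (fst (chart m n k z))) m"
    "coeff (chart_snd m n k z) (n - k) = coeff (poly_of (snd (chart m n k z))) n"
    using exact_pairsD[OF assms] unfolding poly_of_chart by blast+
qed

lemma degree_gcd_chart_ge:
  assumes "chart m n k z \<in> exact_pairs m n"
  shows "k \<le> degree_gcd (chart m n k z)"
proof -
  have "chart_gcd k z dvd gcd (poly_of (fst (chart m n k z))) (poly_of (snd (chart m n k z)))"
    by (simp add: poly_of_chart)
  moreover have "gcd (poly_of (fst (chart m n k z))) (poly_of (snd (chart m n k z))) \<noteq> 0"
    using exact_pairsD(1)[OF assms] by simp
  ultimately show ?thesis
    using dvd_imp_degree_le degree_chart_gcd by metis
qed

lemma C1_near_coeff_mult:
  assumes s: "vector_space s" and x: "x \<in> V"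
    and "\<And>i. C1_near s V x (\<lambda>y. coeff (p y) i)" "\<And>i. C1_near s V x (\<lambda>y. coeff (q y) i)"
  shows "C1_near s V x (\<lambda>y. coeff (p y * q y) i)"
  unfolding coeff_mult using assms(3,4) by (intro C1_near_sum[OF s x] C1_near_mult)

lemma C1_near_coeff_cpoly:
  assumes "vector_space s" "x \<in> V" "\<And>i. C1_near s V x (c i)"
  shows "C1_near s V x (\<lambda>y. coeff (cpoly N (\<lambda>i. c i y)) i)"
  unfolding coeff_cpoly using assms(3) C1_near_const[OF assms(1,2)] by (cases "i < N") simp_all

lemma C1_map_chart:
  assumes k: "k \<le> m" "k \<le> n" and "S \<subseteq> V"
  shows "C1_map scale_coord V scale_pair (poly_pairs m n) S (chart m n k)"
proof -
  note s = vector_space_scale_coord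
  have gcd: "C1_near scale_coord V x (\<lambda>z. coeff (chart_gcd k z) i)" if "x \<in> V" for x i
    unfolding chart_gcd_def coeff_add
    using that by (intro C1_near_add C1_near_const[OF s] C1_near_coeff_cpoly[OF s] C1_near_lookup)
  have cof: "C1_near scale_coord V x (\<lambda>z. coeff (chart_fst m k z) i)"
    "C1_near scale_coord V x (\<lambda>z. coeff (chart_snd m n k z) i)" if "x \<in> V" for x i
    unfolding chart_fst_def chart_snd_def
    using that by (simp_all add: C1_near_coeff_cpoly[OF s] C1_near_lookup)
  show ?thesis
  proof (rule C1_map_into_poly_pairs[OF s assms(3)])
    show "chart m n k ` S \<subseteq> poly_pairs m n"
      using chart_in_poly_pairs[OF k] by blast
    fix x i assume "x \<in> S"
    then have x: "x \<in> V"
      using assms(3) by blast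
    show "C1_near scale_coord V x (\<lambda>z. coeff (poly_of (fst (chart m n k z))) i)"
      "C1_near scale_coord V x (\<lambda>z. coeff (poly_of (snd (chart m n k z))) i)"
      unfolding poly_of_chart by (intro C1_near_coeff_mult[OF s x] gcd[OF x] cof[OF x])+
  qed
qed

text \<open>The monic factor divides both components, so the gcd of a pair of exact degrees in the range
of \<open>chart\<close> has degree at least \<open>k\<close>. Degree exactly \<open>k\<close> is therefore the open condition of having
degree at most \<open>k\<close>.\<close>

lemma openin_chart_domain:
  assumes k: "k \<le> m" "k \<le> n"
  shows "openin (top_of_set (coord_space (m + n + 2 - k))) (chart_domain m n k)"
proof -
  let ?V = "coord_space (m + n + 2 - k)"
  have "chart_domain m n k = ?V \<inter> chart m n k -` {x \<in> exact_pairs m n. degree_gcd x \<le> k}"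
    using degree_gcd_chart_ge[of m n k] by (auto simp: chart_domain_def mem_gcd_pairs intro: antisym)
  moreover have "continuous_on ?V (chart m n k)"
    by (rule C1_map_imp_continuous_on[OF C1_map_chart[OF k order_refl]])
  then have "openin (top_of_set ?V) (?V \<inter> chart m n k -` {x \<in> exact_pairs m n. degree_gcd x \<le> k})"
    using chart_in_poly_pairs[OF k]
    by (intro continuous_openin_preimage[OF _ _ openin_degree_gcd_le]) auto
  ultimately show ?thesis
    by simp
qed

lemma lead_coeff_gcd:
  fixes p q :: "complex poly"
  assumes "p \<noteq> 0"
  shows "lead_coeff (gcd p q) = 1"
  using unit_factor_gcd[of p q] assms
  by (simp add: unit_factor_poly_def one_pCons)

text \<open>The normalization that makes the parametrization injective: a monic common divisor of the
degree of the gcd is the normalized gcd.\<close>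

lemma chart_gcd_eq_gcd:
  assumes "chart m n k z \<in> gcd_pairs m n k"
  shows "chart_gcd k z = gcd (poly_of (fst (chart m n k z))) (poly_of (snd (chart m n k z)))"
    (is "_ = ?g")
proof -
  have ex: "chart m n k z \<in> exact_pairs m n" and deg: "degree ?g = k"
    using assms by (auto simp: mem_gcd_pairs)
  have g0: "?g \<noteq> 0"
    using exact_pairsD(1)[OF ex] by simp
  have "chart_gcd k z dvd ?g"
    by (simp add: poly_of_chart)
  then obtain c where c: "?g = chart_gcd k z * c"
    by (elim dvdE)
  then have "c \<noteq> 0"
    using g0 by auto
  then have "degree c = 0"
    using c deg degree_mult_eq[OF chart_gcd_nonzero[of k z], of c] by (simp add: degree_chart_gcd)
  then obtain a where "c = [:a:]"
    by (rule degree_eq_zeroE)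
  moreover have "lead_coeff ?g = 1"
    by (rule lead_coeff_gcd[OF exact_pairsD(1)[OF ex]])
  ultimately have "a = 1"
    using c lead_coeff_mult[of "chart_gcd k z" c] by (simp add: lead_coeff_chart_gcd)
  then show ?thesis
    using c \<open>c = [:a:]\<close> by (simp add: one_pCons)
qed

lemma inj_on_chart:
  assumes k: "k \<le> m" "k \<le> n"
  shows "inj_on (chart m n k) (chart_domain m n k)"
proof (rule inj_onI)
  fix z z' assume z: "z \<in> chart_domain m n k" "z' \<in> chart_domain m n k"
    and eq: "chart m n k z = chart m n k z'"
  have "chart_gcd k z = chart_gcd k z'"
    using z eq chart_gcd_eq_gcd[of m n k] by (simp add: chart_domain_def)
  moreover from this have "chart_fst m k z = chart_fst m k z'" "chart_snd m n k z = chart_snd m n k z'"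
    using arg_cong[OF eq, of "\<lambda>x. poly_of (fst x)"] arg_cong[OF eq, of "\<lambda>x. poly_of (snd x)"]
      chart_gcd_nonzero[of k z'] by (auto simp: poly_of_chart)
  ultimately have c: "coeff (chart_gcd k z) i = coeff (chart_gcd k z') i"
    "coeff (chart_fst m k z) i = coeff (chart_fst m k z') i"
    "coeff (chart_snd m n k z) i = coeff (chart_snd m n k z') i" for i
    by simp_all
  show "z = z'"
  proof (rule poly_mapping_eqI)
    fix i
    consider "i < k" | "k \<le> i" "i \<le> m" | "m < i" "i < m + n + 2 - k" | "m + n + 2 - k \<le> i"
      by linarith
    then show "Poly_Mapping.lookup z i = Poly_Mapping.lookup z' i"
    proof cases
      case 1
      then show ?thesis
        using c(1)[of i] by (simp add: coeff_chart_gcd)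
    next
      case 2
      then show ?thesis
        using c(2)[of "i - k"] by (simp add: chart_fst_def coeff_cpoly less_Suc_eq_le diff_le_mono)
    next
      case 3
      then have "Suc m + (i - Suc m) = i" "i - Suc m < Suc (n - k)"
        using k by linarith+
      then show ?thesis
        using c(3)[of "i - Suc m"] by (simp only: chart_snd_def coeff_cpoly if_True)
    next
      case 4
      then show ?thesis
        using z by (simp add: chart_domain_def mem_coord_space)
    qed
  qed
qed

lemma chart_image:
  assumes k: "k \<le> m" "k \<le> n"
  shows "chart m n k ` chart_domain m n k = gcd_pairs m n k"
proof
  show "chart m n k ` chart_domain m n k \<subseteq> gcd_pairs m n k"
    by (auto simp: chart_domain_def)
  show "gcd_pairs m n k \<subseteq> chart m n k ` chart_domain m n k"
  proof
    fix x assume x: "x \<in> gcd_pairs m n k"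
    then have ex: "x \<in> exact_pairs m n" and deg_g: "degree_gcd x = k"
      by (simp_all add: mem_gcd_pairs)
    define g where "g = gcd (poly_of (fst x)) (poly_of (snd x))"
    define v where "v = poly_of (fst x) div g"
    define w where "w = poly_of (snd x) div g"
    have g0: "g \<noteq> 0"
      using exact_pairsD(1)[OF ex] by (simp add: g_def)
    have x_eq: "poly_of (fst x) = g * v" "poly_of (snd x) = g * w"
      by (simp_all add: v_def w_def g_def)
    then have "v \<noteq> 0" "w \<noteq> 0"
      using exact_pairsD(1,3)[OF ex] by auto
    then have "m = degree g + degree v" "n = degree g + degree w"
      using exact_pairsD(2,4)[OF ex] unfolding x_eq by (simp_all add: degree_mult_eq g0)
    then have deg: "degree v = m - k" "degree w = n - k"
      using deg_g[folded g_def] by simp_all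
    define c where "c i = (if i < k then coeff g i else if i \<le> m then coeff v (i - k) else coeff w (i - Suc m))" for i
    define z where "z = (\<Sum>i<m + n + 2 - k. scale_coord (c i) (Poly_Mapping.single i 1))"
    have z: "Poly_Mapping.lookup z i = (if i < m + n + 2 - k then c i else 0)" for i
      by (simp add: z_def lookup_sum_scale_single)
    have lead: "coeff g k = 1"
      using lead_coeff_gcd[OF exact_pairsD(1)[OF ex], of "poly_of (snd x)"] deg_g by (simp add: g_def)
    have "chart_gcd k z = g"
      using deg_g lead k by (auto simp: poly_eq_iff coeff_chart_gcd z c_def g_def coeff_eq_0)
    moreover have "chart_fst m k z = v"
      using deg k by (auto simp: poly_eq_iff chart_fst_def coeff_cpoly z c_def coeff_eq_0)
    moreover have "chart_snd m n k z = w"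
      using deg k by (auto simp: poly_eq_iff chart_snd_def coeff_cpoly z c_def coeff_eq_0)
    ultimately have "chart m n k z = x"
      by (simp add: prod_eq_iff poly_of_inject[symmetric] poly_of_chart x_eq)
    moreover have "z \<in> chart_domain m n k"
      using x \<open>chart m n k z = x\<close> by (simp add: chart_domain_def mem_coord_space z)
    ultimately show "x \<in> chart m n k ` chart_domain m n k"
      by blast
  qed
qed

text \<open>Near a point \<open>x\<close> of the stratum the coordinates of a pair \<open>(p, q)\<close> are recovered by solving two linear
systems. The cofactors \<open>v\<close> and \<open>w\<close> have the leading coefficients of \<open>p\<close> and \<open>q\<close>, as the common factor
is monic; the remaining coefficients solve the inhomogeneous system obtained from \<open>p * w = q * v\<close>, whose
matrix is the injective matrix of syzygies. The lower coefficients of the common factor \<open>u\<close> then solve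
\<open>v * u = p\<close>, an injective system as \<open>v \<noteq> 0\<close>. The two solutions are functions of class C1 on a full
neighbourhood of \<open>x\<close> among all pairs, where the systems need not be solvable; on the stratum they
are the coordinates.\<close>

lemma C1_map_chart_inverse:
  assumes k: "k \<le> m" "k \<le> n"
    and g: "\<And>x. x \<in> gcd_pairs m n k \<Longrightarrow> g x \<in> coord_space (m + n + 2 - k) \<and> chart m n k (g x) = x"
  shows "C1_map scale_pair (poly_pairs m n) scale_coord (coord_space (m + n + 2 - k)) (gcd_pairs m n k) g"
proof (rule C1_map_into_coord_space[OF vector_space_scale_pair])
  let ?V = "poly_pairs m n" and ?M = "gcd_pairs m n k"
  show "g ` ?M \<subseteq> coord_space (m + n + 2 - k)"
    using g by blast
  fix x assume xM: "x \<in> ?M"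
  then have ex: "x \<in> exact_pairs m n" and deg: "degree_gcd x \<le> k" and x: "x \<in> ?V"
    by (simp_all add: mem_gcd_pairs mem_exact_pairs)
  note s = vector_space_scale_pair
  note C1 = C1_near_const[OF s x] C1_near_mult C1_near_diff[OF s x] C1_near_mult_matrix[OF s x]
    C1_near_coeff_fst[OF x] C1_near_coeff_snd[OF x] C1_near_syzygy_matrix[OF x]
  define p where "p y = poly_of (fst y)" for y :: "npoly \<times> npoly"
  define q where "q y = poly_of (snd y)" for y :: "npoly \<times> npoly"
  define u where "u y = chart_gcd k (g y)" for y
  define v where "v y = chart_fst m k (g y)" for y
  define w where "w y = chart_snd m n k (g y)" for y
  have factor: "p y = u y * v y" "q y = u y * w y" if "y \<in> ?M" for y
    using g[OF that] poly_of_chart[of m n k "g y"] by (simp_all add: p_def q_def u_def v_def w_def)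
  have cof: "degree (v y) = m - k" "degree (w y) = n - k"
    "coeff (v y) (m - k) = coeff (p y) m" "coeff (w y) (n - k) = coeff (q y) n" if "y \<in> ?M" for y
    using chart_cofactors[of m n k "g y"] g[OF that] that
    by (simp_all add: p_def q_def v_def w_def mem_gcd_pairs)

  let ?J = "{..<n - k} <+> {..<m - k}"
  \<comment> \<open>The leading terms of the cofactors, moved to the right-hand side.\<close>
  define b where "b i y = mult_matrix (coeff (q y)) i (m - k) * coeff (p y) m
    - mult_matrix (coeff (p y)) i (n - k) * coeff (q y) n" for i y
  have "\<exists>U t. openin (top_of_set ?V) U \<and> x \<in> U \<and> (\<forall>l\<in>?J. C1_near scale_pair ?V x (t l)) \<and>
    (\<forall>y\<in>U. \<forall>z. (\<forall>i. (\<Sum>l\<in>?J. syzygy_matrix (p y) (q y) i l * z l) = b i y) \<longrightarrow>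
      (\<forall>l\<in>?J. z l = t l y))"
  proof (rule C1_near_linear_system[OF s x])
    show "C1_near scale_pair ?V x (\<lambda>y. syzygy_matrix (p y) (q y) i l)" for i l
      unfolding p_def q_def by (rule C1)
    show "C1_near scale_pair ?V x (b i)" for i
      unfolding b_def[abs_def] p_def q_def by (intro C1)
    show "\<forall>l\<in>?J. z l = 0" if "\<And>i. (\<Sum>l\<in>?J. syzygy_matrix (p x) (q x) i l * z l) = 0" for z
      using degree_gcd_le_iff_syzygy_trivial[OF exact_pairsD[OF ex], of k, THEN iffD1, OF deg] that
      unfolding p_def q_def by blast
  qed simp
  then obtain U t where U: "openin (top_of_set ?V) U" "x \<in> U"
    and t: "\<forall>l\<in>?J. C1_near scale_pair ?V x (t l)"
    and sol: "\<forall>y\<in>U. \<forall>z. (\<forall>i. (\<Sum>l\<in>?J. syzygy_matrix (p y) (q y) i l * z l) = b i y) \<longrightarrow>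
      (\<forall>l\<in>?J. z l = t l y)"
    by (elim exE conjE) (rule that)
  have t_eq: "\<forall>l\<in>?J. case_sum (coeff (w y)) (coeff (v y)) l = t l y" if y: "y \<in> U" "y \<in> ?M" for y
  proof -
    let ?z = "case_sum (coeff (w y)) (coeff (v y))"
    have split: "r = cpoly d (coeff r) + monom (coeff r d) d" if "degree r = d" for r :: "complex poly" and d
      using that by (auto simp: poly_eq_iff coeff_cpoly coeff_eq_0)
    have w': "cpoly (n - k) (coeff (w y)) = w y - monom (coeff (q y) n) (n - k)"
      using split[OF cof(2)[OF y(2)]] cof(4)[OF y(2)] by (simp add: eq_diff_eq)
    have v': "cpoly (m - k) (coeff (v y)) = v y - monom (coeff (p y) m) (m - k)"
      using split[OF cof(1)[OF y(2)]] cof(3)[OF y(2)] by (simp add: eq_diff_eq)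
    have "p y * cpoly (n - k) (?z \<circ> Inl) - q y * cpoly (m - k) (?z \<circ> Inr)
        = q y * monom (coeff (p y) m) (m - k) - p y * monom (coeff (q y) n) (n - k)"
      unfolding case_sum_o_inj w' v' using factor[OF y(2)] by (simp add: algebra_simps)
    then have "\<forall>i. (\<Sum>l\<in>?J. syzygy_matrix (p y) (q y) i l * ?z l) = b i y"
      by (simp add: sum_syzygy_matrix b_def coeff_mult_monom_mult_matrix)
    then show ?thesis
      using sol y(1) by blast
  qed
  \<comment> \<open>All coefficients of the cofactors; those at \<open>m - k\<close> and \<open>n - k\<close> are the known leading ones.\<close>
  define cv where "cv i = (if i < m - k then t (Inr i) else if i = m - k then (\<lambda>y. coeff (p y) m) else (\<lambda>_. 0))" for i
  define cw where "cw i = (if i < n - k then t (Inl i) else if i = n - k then (\<lambda>y. coeff (q y) n) else (\<lambda>_. 0))" for i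
  have C1_c: "C1_near scale_pair ?V x (cv i)" "C1_near scale_pair ?V x (cw i)" for i
    using t C1(1) C1_near_coeff_fst[OF x] C1_near_coeff_snd[OF x]
    by (auto simp: cv_def cw_def p_def q_def)
  have v_eq: "coeff (v y) i = cv i y" and w_eq: "coeff (w y) i = cw i y" if y: "y \<in> U" "y \<in> ?M" for y i
    using bspec[OF t_eq[OF y], of "Inr i"] bspec[OF t_eq[OF y], of "Inl i"] cof[OF y(2)]
    by (auto simp: cv_def cw_def coeff_eq_0)

  \<comment> \<open>The second system: the unknowns are the coefficients of \<open>u\<close> below its leading term \<open>x ^ k\<close>.\<close>
  have "\<exists>U' r. openin (top_of_set ?V) U' \<and> x \<in> U' \<and> (\<forall>l\<in>{..<k}. C1_near scale_pair ?V x (r l)) \<and>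
    (\<forall>y\<in>U'. \<forall>z. (\<forall>i. (\<Sum>l<k. mult_matrix (\<lambda>i. cv i y) i l * z l)
        = coeff (p y) i - mult_matrix (\<lambda>i. cv i y) i k) \<longrightarrow>
      (\<forall>l\<in>{..<k}. z l = r l y))"
  proof (rule C1_near_linear_system[OF s x])
    show "C1_near scale_pair ?V x (\<lambda>y. mult_matrix (\<lambda>i. cv i y) i l)" for i l
      using C1_c by (intro C1)
    show "C1_near scale_pair ?V x (\<lambda>y. coeff (p y) i - mult_matrix (\<lambda>i. cv i y) i k)" for i
      unfolding p_def using C1_c by (intro C1)
    fix z assume z: "\<And>i. (\<Sum>l<k. mult_matrix (\<lambda>i. cv i x) i l * z l) = 0"
    have "v x * cpoly k z = 0"
    proof (rule poly_eqI)
      have "coeff (v x) = (\<lambda>i. cv i x)"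
        using v_eq[OF U(2) xM] by blast
      then show "coeff (v x * cpoly k z) i = coeff 0 i" for i
        by (simp add: coeff_mult_cpoly z)
    qed
    moreover have "v x \<noteq> 0"
      using factor(1)[OF xM] exact_pairsD(1)[OF ex] by (auto simp: p_def)
    ultimately show "\<forall>l\<in>{..<k}. z l = 0"
      by (simp add: cpoly_eq_0_iff)
  qed simp
  then obtain U' r where U': "openin (top_of_set ?V) U'" "x \<in> U'"
    and r: "\<forall>l\<in>{..<k}. C1_near scale_pair ?V x (r l)"
    and sol': "\<forall>y\<in>U'. \<forall>z. (\<forall>i. (\<Sum>l<k. mult_matrix (\<lambda>i. cv i y) i l * z l)
        = coeff (p y) i - mult_matrix (\<lambda>i. cv i y) i k) \<longrightarrow> (\<forall>l\<in>{..<k}. z l = r l y)"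
    by (elim exE conjE) (rule that)
  have r_eq: "\<forall>l\<in>{..<k}. Poly_Mapping.lookup (g y) l = r l y" if y: "y \<in> U \<inter> U'" "y \<in> ?M" for y
  proof -
    have "p y = v y * monom 1 k + v y * cpoly k (Poly_Mapping.lookup (g y))"
      using factor(1)[OF y(2)] by (simp add: u_def chart_gcd_def algebra_simps)
    then have "(\<Sum>l<k. mult_matrix (coeff (v y)) i l * Poly_Mapping.lookup (g y) l)
        = coeff (p y) i - mult_matrix (coeff (v y)) i k" for i
      by (simp add: coeff_mult_monom_mult_matrix coeff_mult_cpoly)
    moreover have "coeff (v y) = (\<lambda>i. cv i y)"
      using v_eq y by blast
    ultimately show ?thesis
      using sol' y(1) by simp
  qed

  define \<phi> where "\<phi> i = (if i < k then r i else if i \<le> m then cv (i - k) else cw (i - Suc m))" for i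
  have "Poly_Mapping.lookup (g y) i = \<phi> i y" if y: "y \<in> ?M \<inter> (U \<inter> U')" and i: "i < m + n + 2 - k" for y i
  proof -
    have yM: "y \<in> U" "y \<in> ?M"
      using y by auto
    consider "i < k" | "k \<le> i" "i \<le> m" | "k \<le> i" "m < i"
      by linarith
    then show ?thesis
    proof cases
      case 1
      then show ?thesis
        using r_eq[of y] y by (simp add: \<phi>_def)
    next
      case 2
      then have "k + (i - k) = i" "i - k < Suc (m - k)"
        by linarith+
      then have "coeff (v y) (i - k) = Poly_Mapping.lookup (g y) i"
        by (simp only: v_def chart_fst_def coeff_cpoly if_True)
      then show ?thesis
        using 2 v_eq[OF yM] by (simp add: \<phi>_def)
    next
      case 3
      then have "Suc m + (i - Suc m) = i" "i - Suc m < Suc (n - k)"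
        using i k by linarith+
      then have "coeff (w y) (i - Suc m) = Poly_Mapping.lookup (g y) i"
        by (simp only: w_def chart_snd_def coeff_cpoly if_True)
      then show ?thesis
        using 3 w_eq[OF yM] by (simp add: \<phi>_def)
    qed
  qed
  moreover have "C1_near scale_pair ?V x (\<phi> i)" for i
    using r C1_c by (simp add: \<phi>_def)
  ultimately show "\<exists>U \<phi>. openin (top_of_set ?V) U \<and> x \<in> U \<and>
      (\<forall>i<m + n + 2 - k. C1_near scale_pair ?V x (\<phi> i)) \<and>
      (\<forall>y\<in>?M \<inter> U. \<forall>i<m + n + 2 - k. Poly_Mapping.lookup (g y) i = \<phi> i y)"
    using U U' by (intro exI[of _ "U \<inter> U'"] exI[of _ \<phi>]) auto
qed

lemma manifold_of_codim_gcd_pairs: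
  assumes k: "k \<le> m" "k \<le> n"
  shows "manifold_of_codim m n k (gcd_pairs m n k)"
proof -
  let ?d = "m + n + 2 - k" and ?V = "poly_pairs m n" and ?M = "gcd_pairs m n k"
  let ?L = "chart_domain m n k" and ?h = "chart m n k"
  define g where "g = the_inv_into ?L ?h"
  have hg: "?h (g y) = y" "g y \<in> ?L" if "y \<in> ?M" for y
    using f_the_inv_into_f[OF inj_on_chart[OF k]] the_inv_into_into[OF inj_on_chart[OF k] _ order_refl]
      that by (auto simp: chart_image[OF k] g_def)
  have gh: "g (?h z) = z" if "z \<in> ?L" for z
    using the_inv_into_f_f[OF inj_on_chart[OF k] that] by (simp add: g_def)
  have sub: "?M \<subseteq> ?V"
    by (auto simp: mem_gcd_pairs mem_exact_pairs)
  have L: "?L \<subseteq> coord_space ?d"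
    by (auto simp: chart_domain_def)
  have "g ` ?M = ?L"
  proof
    show "g ` ?M \<subseteq> ?L"
      using hg(2) by blast
    show "?L \<subseteq> g ` ?M"
    proof
      fix z assume "z \<in> ?L"
      then show "z \<in> g ` ?M"
        using gh[of z, symmetric] chart_image[OF k] by (intro image_eqI) auto
    qed
  qed
  moreover have "C1_map scale_pair ?V scale_coord (coord_space ?d) ?M g"
    using hg L by (intro C1_map_chart_inverse[OF k]) blast
  moreover have "?V \<inter> ?M = ?M"
    using sub by blast
  ultimately have "differentiable_manifold m n ?d ?M"
    unfolding differentiable_manifold_def
  proof (intro conjI ballI sub, goal_cases)
    case (1 x)
    show ?case
    proof (rule exI[of _ ?V], rule exI[of _ ?L], rule exI[of _ g], rule exI[of _ ?h],
        unfold 1(3), intro conjI ballI)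
      show "openin (top_of_set ?V) ?V"
        by simp
      show "x \<in> ?V"
        using 1(4) sub by blast
    qed (fact 1 hg gh chart_image[OF k] openin_chart_domain[OF k] C1_map_chart[OF k L])+
  qed
  moreover have "k + ?d = m + n + 2"
    using k by simp
  ultimately show ?thesis
    unfolding manifold_of_codim_def by blast
qed

section \<open>Closures of the strata\<close>

lemma exists_dvd_of_degree:
  fixes g :: "complex poly"
  assumes "g \<noteq> 0"
  shows "k \<le> degree g \<Longrightarrow> \<exists>a. a dvd g \<and> degree a = k"
proof (induction k)
  case 0
  then show ?case
    by (intro exI[of _ 1]) simp
next
  case (Suc k)
  then obtain a b where g: "g = a * b" and a: "degree a = k"
    by (auto elim: dvdE)
  with assms have nz: "a \<noteq> 0" "b \<noteq> 0"
    by auto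
  then have "degree b \<noteq> 0"
    using Suc.prems a by (simp add: g degree_mult_eq)
  then obtain z where "poly b z = 0"
    using Fundamental_Theorem_Algebra.fundamental_theorem_of_algebra constant_degree by metis
  then have "[:- z, 1:] dvd b"
    by (simp add: poly_eq_0_iff_dvd)
  then have "a * [:- z, 1:] dvd g"
    unfolding g by (rule mult_dvd_mono[OF dvd_refl])
  moreover have "degree (a * [:- z, 1:]) = Suc k"
    using nz(1) a degree_mult_eq[of a "[:- z, 1:]"] by simp
  ultimately show ?case
    by blast
qed

lemma coprime_if_no_common_root:
  fixes p q :: "complex poly"
  assumes "p \<noteq> 0" "\<And>z. poly p z = 0 \<Longrightarrow> poly q z \<noteq> 0"
  shows "coprime p q"
proof -
  have "degree (gcd p q) = 0"
  proof (rule ccontr)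
    assume "degree (gcd p q) \<noteq> 0"
    then obtain z where "poly (gcd p q) z = 0"
      using Fundamental_Theorem_Algebra.fundamental_theorem_of_algebra constant_degree by metis
    then have "[:- z, 1:] dvd gcd p q"
      by (simp add: poly_eq_0_iff_dvd)
    then have "poly p z = 0" "poly q z = 0"
      by (simp_all add: poly_eq_0_iff_dvd)
    then show False
      using assms(2) by blast
  qed
  moreover have "gcd p q \<noteq> 0"
    using assms(1) by simp
  ultimately have "is_unit (gcd p q)"
    using is_unit_iff_degree by blast
  then show ?thesis
    by (simp only: is_unit_gcd)
qed

lemma degree_gcd_mult_coprime:
  fixes a u v :: "complex poly"
  assumes "coprime u v" "a \<noteq> 0"
  shows "degree (gcd (a * u) (a * v)) = degree a"
proof -
  have "gcd (a * u) (a * v) = normalize a"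
    using assms(1) by (simp add: gcd_mult_left)
  moreover have "degree (normalize a) = degree a"
    using assms(2) by (intro antisym dvd_imp_degree_le) auto
  ultimately show ?thesis
    by simp
qed

text \<open>A neighbourhood of \<open>x\<close> contains \<open>x + c d\<close> for infinitely many scalars \<open>c\<close>, hence for one that avoids
the exceptional set \<open>B\<close>.\<close>

lemma closure_ofI_generic_perturbation:
  assumes x: "x \<in> poly_pairs m n" and "finite B"
    and S: "S \<subseteq> poly_pairs m n" "\<And>c. c \<notin> B \<Longrightarrow> x + scale_pair c d \<in> S"
  shows "x \<in> top_of_set (poly_pairs m n) closure_of S"
  unfolding in_closure_of
proof (intro conjI allI impI)
  show "x \<in> topspace (top_of_set (poly_pairs m n))"
    using x by simp
  fix T assume T: "x \<in> T \<and> openin (top_of_set (poly_pairs m n)) T"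
  then obtain O' where O': "open O'" "T = poly_pairs m n \<inter> O'"
    by (auto simp: openin_open)
  interpret P: vector_space scale_pair
    by (rule vector_space_scale_pair)
  have "continuous_on UNIV (\<lambda>c. x + scale_pair c d)"
    by (intro continuous_intros linear_continuous_on bounded_linear_scale_pair)
  then have "open ((\<lambda>c. x + scale_pair c d) -` O')"
    using O'(1) open_vimage by blast
  moreover have "0 \<in> (\<lambda>c. x + scale_pair c d) -` O'"
    using T O'(2) by (simp add: P.scale_zero_left)
  ultimately have "infinite ((\<lambda>c. x + scale_pair c d) -` O')"
    using infinite_openin[of UNIV _ "0 :: complex"] islimpt_UNIV by simp
  then obtain c where "x + scale_pair c d \<in> O'" "c \<notin> B"
    using \<open>finite B\<close> by (metis finite_subset subsetI vimageE)
  then show "\<exists>y. y \<in> S \<and> y \<in> T"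
    using S O'(2) by blast
qed

lemma exact_pairs_dense:
  "poly_pairs m n \<subseteq> top_of_set (poly_pairs m n) closure_of exact_pairs m n"
proof
  fix x assume x: "x \<in> poly_pairs m n"
  define d where "d = (npoly_of (monom 1 m), npoly_of (monom 1 n))"
  show "x \<in> top_of_set (poly_pairs m n) closure_of exact_pairs m n"
  proof (rule closure_ofI_generic_perturbation[OF x])
    show "exact_pairs m n \<subseteq> poly_pairs m n"
      by (auto simp: mem_exact_pairs)
    show "x + scale_pair c d \<in> exact_pairs m n"
      if "c \<notin> {- coeff (poly_of (fst x)) m, - coeff (poly_of (snd x)) n}" for c
      using that x
      by (auto simp: mem_exact_pairs mem_poly_pairs d_def scale_pair_def scale_npoly.rep_eq
          plus_npoly.rep_eq npoly_of_inverse smult_monom add_eq_0_iff2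
          intro!: degree_add_le degree_monom_le)
  qed simp
qed

text \<open>Split off a common factor \<open>a\<close> of degree exactly \<open>k\<close>, so that the pair is \<open>(a * u, a * v)\<close>, and replace \<open>v\<close>
by \<open>v + c\<close>. This is coprime to \<open>u\<close> unless \<open>- c\<close> is one of the finitely many values of \<open>v\<close> at roots
of \<open>u\<close>, and then \<open>a\<close> is a gcd of the new pair.\<close>

lemma gcd_pairs_subset_closure_of:
  assumes "k \<le> j"
  shows "gcd_pairs m n j \<subseteq> top_of_set (poly_pairs m n) closure_of gcd_pairs m n k"
proof
  fix x assume "x \<in> gcd_pairs m n j"
  then have ex: "x \<in> exact_pairs m n" and deg_g: "degree_gcd x = j"
    by (simp_all add: mem_gcd_pairs)
  define p where "p = poly_of (fst x)"
  define q where "q = poly_of (snd x)"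
  have pq: "p \<noteq> 0" "degree p = m" "q \<noteq> 0" "degree q = n"
    using exact_pairsD[OF ex] by (simp_all add: p_def q_def)
  have "gcd p q \<noteq> 0"
    using pq by simp
  then obtain a where a: "a dvd gcd p q" "degree a = k"
    using exists_dvd_of_degree[of "gcd p q" k] deg_g assms by (auto simp: p_def q_def)
  then have "a dvd p" "a dvd q"
    by simp_all
  then obtain u v where p_eq: "p = a * u" and q_eq: "q = a * v"
    by (elim dvdE)
  have nz: "a \<noteq> 0" "u \<noteq> 0" "v \<noteq> 0"
    using pq p_eq q_eq by auto
  \<comment> \<open>Excluding \<open>- coeff v 0\<close> keeps the degree of \<open>v + c\<close> when \<open>v\<close> is constant.\<close>
  define B where "B = insert (- coeff v 0) ((\<lambda>z. - poly v z) ` {z. poly u z = 0})"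
  show "x \<in> top_of_set (poly_pairs m n) closure_of gcd_pairs m n k"
  proof (rule closure_ofI_generic_perturbation)
    show "x \<in> poly_pairs m n" "gcd_pairs m n k \<subseteq> poly_pairs m n"
      using ex by (auto simp: mem_gcd_pairs mem_exact_pairs)
    show "finite B"
      using poly_roots_finite[OF nz(2)] by (simp add: B_def)
    fix c assume c: "c \<notin> B"
    define y where "y = x + scale_pair c (0, npoly_of a)"
    have y: "poly_of (fst y) = a * u" "poly_of (snd y) = a * (v + [:c:])"
      using p_eq q_eq by (simp_all add: y_def p_def q_def scale_pair_def scale_npoly.rep_eq
          plus_npoly.rep_eq zero_npoly.rep_eq npoly_of_inverse algebra_simps)
    have "coprime u (v + [:c:])"
    proof (rule coprime_if_no_common_root[OF nz(2)])
      fix z assume "poly u z = 0"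
      then have "c \<noteq> - poly v z"
        using c by (auto simp: B_def)
      then show "poly (v + [:c:]) z \<noteq> 0"
        by (simp add: add_eq_0_iff)
    qed
    then have "degree_gcd y = k"
      using degree_gcd_mult_coprime[of u "v + [:c:]" a] nz(1) a(2) by (simp add: y)
    moreover have "coeff (v + [:c:]) 0 \<noteq> 0"
      using c by (auto simp: B_def add_eq_0_iff)
    then have "v + [:c:] \<noteq> 0"
      by (metis coeff_0)
    moreover have "degree (v + [:c:]) = degree v"
    proof (cases "degree v = 0")
      case True
      then show ?thesis
        using degree_add_le[of v 0 "[:c:]"] by simp
    qed (simp add: degree_add_eq_left)
    ultimately show "y \<in> gcd_pairs m n k"
      using nz pq unfolding p_eq q_eq
      by (simp add: mem_gcd_pairs exact_pairs_def mem_poly_pairs y degree_mult_eq case_prod_unfold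
          poly_of_eq_0_iff[symmetric])
  qed
qed

text \<open>The pair of monomials of degrees \<open>m\<close> and \<open>n\<close> has a gcd of the largest possible degree, so it lies in
the closure of every stratum.\<close>

lemma gcd_pairs_nonempty:
  assumes "j \<le> min m n"
  shows "gcd_pairs m n j \<noteq> {}"
proof -
  define x where "x = (npoly_of (monom 1 m), npoly_of (monom 1 n))"
  have x: "poly_of (fst x) = monom 1 m" "poly_of (snd x) = monom 1 n"
    by (simp_all add: x_def npoly_of_inverse)
  have ex: "x \<in> exact_pairs m n"
    by (simp add: mem_exact_pairs mem_poly_pairs x degree_monom_eq)
  have "monom 1 (min m n) dvd (gcd (monom 1 m) (monom 1 n) :: complex poly)"
    by (intro gcd_greatest) (simp_all add: monom_1_dvd_iff')
  then have deg: "min m n \<le> degree_gcd x"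
    using dvd_imp_degree_le[of "monom 1 (min m n)" "gcd (monom 1 m) (monom 1 n) :: complex poly"]
    by (simp add: x degree_monom_eq)
  have "j \<le> degree_gcd x"
    using assms deg by (rule order_trans)
  then have "x \<in> top_of_set (poly_pairs m n) closure_of gcd_pairs m n j"
    using gcd_pairs_subset_closure_of[of j "degree_gcd x" m n] ex by (auto simp: mem_gcd_pairs)
  then show ?thesis
    by auto
qed

lemma gcd_pairs_subset_closure_of_iff:
  assumes "j \<le> min m n"
  shows "gcd_pairs m n j \<subseteq> top_of_set (poly_pairs m n) closure_of gcd_pairs m n k \<longleftrightarrow> k \<le> j"
proof
  assume sub: "gcd_pairs m n j \<subseteq> top_of_set (poly_pairs m n) closure_of gcd_pairs m n k"
  obtain x where x: "x \<in> gcd_pairs m n j"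
    using gcd_pairs_nonempty[OF assms] by blast
  let ?U = "{x \<in> exact_pairs m n. degree_gcd x \<le> j}"
  have "x \<in> ?U"
    using x by (simp add: mem_gcd_pairs)
  have "\<forall>T. x \<in> T \<and> openin (top_of_set (poly_pairs m n)) T \<longrightarrow> (\<exists>y. y \<in> gcd_pairs m n k \<and> y \<in> T)"
    using subsetD[OF sub x] unfolding in_closure_of by (rule conjunct2)
  from this[rule_format, OF conjI[OF \<open>x \<in> ?U\<close> openin_degree_gcd_le]]
  obtain y where "y \<in> gcd_pairs m n k" "y \<in> ?U"
    by (elim exE conjE)
  then show "k \<le> j"
    by (simp add: mem_gcd_pairs)
qed (rule gcd_pairs_subset_closure_of)

lemma closure_of_coprime_pairs:
  "top_of_set (poly_pairs m n) closure_of gcd_pairs m n 0 = poly_pairs m n"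
proof
  let ?cl = "\<lambda>S. top_of_set (poly_pairs m n) closure_of S"
  show "?cl (gcd_pairs m n 0) \<subseteq> poly_pairs m n"
    using closure_of_subset_topspace[of "top_of_set (poly_pairs m n)"] by simp
  have "exact_pairs m n \<subseteq> ?cl (gcd_pairs m n 0)"
  proof
    fix x assume "x \<in> exact_pairs m n"
    then have "x \<in> gcd_pairs m n (degree_gcd x)"
      by (simp add: mem_gcd_pairs)
    then show "x \<in> ?cl (gcd_pairs m n 0)"
      using gcd_pairs_subset_closure_of[of 0 "degree_gcd x" m n] by blast
  qed
  then have "?cl (exact_pairs m n) \<subseteq> ?cl (gcd_pairs m n 0)"
    using closure_of_mono closure_of_closure_of by metis
  then show "poly_pairs m n \<subseteq> ?cl (gcd_pairs m n 0)"
    using exact_pairs_dense by blast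
qed

section \<open>The strata of pairs with given degree of the gcd\<close>

theorem theorem4p3:
  fixes m n :: nat
  shows "(\<forall>k \<le> min m n. manifold_of_codim m n k (gcd_pairs m n k)) \<and>
    (\<forall>j \<le> min m n. \<forall>k \<le> min m n.
       gcd_pairs m n j \<subseteq> top_of_set (poly_pairs m n) closure_of gcd_pairs m n k \<longleftrightarrow> k \<le> j) \<and>
    openin (top_of_set (poly_pairs m n)) (gcd_pairs m n 0) \<and>
    top_of_set (poly_pairs m n) closure_of gcd_pairs m n 0 = poly_pairs m n"
proof -
  have "gcd_pairs m n 0 = {x \<in> exact_pairs m n. degree_gcd x \<le> 0}"
    by (auto simp: mem_gcd_pairs)
  then have "openin (top_of_set (poly_pairs m n)) (gcd_pairs m n 0)"
    using openin_degree_gcd_le[of m n 0] by simp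
  then show ?thesis
    by (simp add: manifold_of_codim_gcd_pairs gcd_pairs_subset_closure_of_iff closure_of_coprime_pairs)
qed

end
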